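(* For all partitions $\mu,\nu$ the following identities of functions of $q$ hold (skew Schur functions at $(1,q,q^2,\dots)$ being rational functions of $q$): $$s_\nu(\mathcal{E}_\mu(q,t))=(-1)^{|\nu|}q^{\kappa_\nu/2}\sum_{\rho}q^{-|\rho|}\,\frac{s_{\mu/\rho}(1,q,q^2,\dots)}{s_\mu(1,q,q^2,\dots)}\,s_{\nu/\rho}(1,q,q^2,\dots)$$ and $$\mathcal{W}_{\mu,\nu}(q)=(-1)^{|\mu|+|\nu|}q^{\frac{\kappa_\mu+\kappa_\nu+|\mu|+|\nu|}{2}}\sum_{\rho}q^{-|\rho|}\,s_{\mu/\rho}(1,q,q^2,\dots)\,s_{\nu/\rho}(1,q,q^2,\dots),$$ where the sums run over all partitions $\rho$ (including the empty one).
   Context: Partitions may be empty. For a partition $\mu=(\mu_1\ge\dots\ge\mu_{l(\mu)}>0)$: $|\mu|=\sum_i\mu_i$, $l(\mu)$ is the number of parts, $\kappa_\mu=\sum_i\mu_i(\mu_i-2i+1)$, $\mu'$ is the conjugate partition. Write $[m]=q^{m/2}-q^{-m/2}$. Define $$\mathcal{W}_\mu(q)=q^{\kappa_\mu/4}\prod_{1\le i<j\le l(\mu)}\frac{[\mu_i-\mu_j+j-i]}{[j-i]}\prod_{i=1}^{l(\mu)}\prod_{v=1}^{\mu_i}\frac{1}{[v-i+l(\mu)]},$$ $$\mathcal{E}_\mu(q,t)=\prod_{j=1}^{l(\mu)}\frac{1+q^{\mu_j-j}t}{1+q^{-j}t}\cdot\Big(1+\sum_{n\ge1}\frac{t^n}{\prod_{i=1}^n(q^i-1)}\Big),$$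 $$\mathcal{W}_{\mu,\nu}(q)=q^{|\nu|/2}\,\mathcal{W}_\mu(q)\,s_\nu(\mathcal{E}_\mu(q,t)).$$ For a power series $\mathcal{E}(t)=\sum_{i\ge0}e_it^i$ with $e_0=1$ (and $e_i=0$ for $i<0$), $s_\nu(\mathcal{E}(t)):=\det(e_{\nu'_i-i+j})_{1\le i,j\le l(\nu')}$. The skew Schur function $s_{\mu/\rho}$ is defined by $\langle s_{\mu/\rho},s_\sigma\rangle=\langle s_\mu,s_\rho s_\sigma\rangle$ for all $\sigma$; it vanishes unless $\rho\subset\mu$, and $s_{\mu/\rho}=\det(h_{\mu_i-\rho_j-i+j})_{1\le i,j\le n}$ for $n\ge l(\mu),l(\rho)$. Its value at $(1,q,q^2,\dots)$ is the rational function of $q$ obtained from $h_n(1,q,q^2,\dots)=\prod_{i=1}^n(1-q^i)^{-1}$ (for $|q|<1$ this is the value of the convergent series). *)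

theory Defs
  imports
    "HOL-Library.Multiset"
    "HOL-Library.Poly_Mapping"
    "HOL-Library.Groups_Big_Fun"
    "HOL-Computational_Algebra.Formal_Power_Series"
    "Jordan_Normal_Form.Determinant"
begin

section \<open>Partitions\<close>

typedef partition = "{xs :: nat list. sorted_wrt (\<ge>) xs \<and> 0 \<notin> set xs}"
  morphisms parts Partition
  by (rule exI[of _ "[]"]) simp

text \<open>Parts are indexed from 1, as in the usual notation; outside the range the part is 0.\<close>

definition part :: "partition \<Rightarrow> nat \<Rightarrow> nat" where
  "part \<mu> i = (if 1 \<le> i \<and> i \<le> length (parts \<mu>) then parts \<mu> ! (i - 1) else 0)"

definition plength :: "partition \<Rightarrow> nat" where
  "plength \<mu> = length (parts \<mu>)"

definition psize :: "partition \<Rightarrow> nat" where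
  "psize \<mu> = (\<Sum>i = 1..plength \<mu>. part \<mu> i)"

definition kappa :: "partition \<Rightarrow> int" where
  "kappa \<mu> = (\<Sum>i = 1..plength \<mu>. int (part \<mu> i) * (int (part \<mu> i) - 2 * int i + 1))"

definition conjugate :: "partition \<Rightarrow> partition" where
  "conjugate \<mu> =
     Partition (map (\<lambda>i. card {j \<in> {1..plength \<mu>}. i \<le> part \<mu> j}) [1..<Suc (part \<mu> 1)])"

lemma parts_conjugate:
  "parts (conjugate \<mu>) =
     map (\<lambda>i. card {j \<in> {1..plength \<mu>}. i \<le> part \<mu> j}) [1..<Suc (part \<mu> 1)]"
proof -
  let ?f = "\<lambda>i. card {j \<in> {1..plength \<mu>}. i \<le> part \<mu> j}"
  have "sorted_wrt (\<ge>) (map ?f [1..<Suc (part \<mu> 1)])"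
    by (auto simp: sorted_wrt_iff_nth_less simp del: upt_Suc intro!: card_mono)
  moreover have "?f i \<noteq> 0" if "1 \<le> i" "i \<le> part \<mu> 1" for i
  proof -
    have "1 \<le> plength \<mu>"
      using that by (auto simp: part_def plength_def split: if_splits)
    then have "1 \<in> {j \<in> {1..plength \<mu>}. i \<le> part \<mu> j}"
      using that by simp
    then show ?thesis by (auto simp: card_eq_0_iff)
  qed
  then have "0 \<notin> set (map ?f [1..<Suc (part \<mu> 1)])"
    by (fastforce simp: less_Suc_eq_le simp del: upt_Suc)
  ultimately show ?thesis
    unfolding conjugate_def by (intro Partition_inverse) simp
qed

text \<open>Every exponent $\kappa_\mu/2$ is an integer, so that \<open>kappa \<mu> div 2\<close> is exact.\<close>

lemma even_kappa: "even (kappa \<mu>)"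
proof -
  have "even (int m * (int m - 2 * int i + 1))" for m i :: nat
    by simp
  then show ?thesis
    unfolding kappa_def by (intro dvd_sum) blast
qed


section \<open>Symmetric functions\<close>

text \<open>
  The ring $\Lambda = \mathbb{Z}[h_1, h_2, \dots]$ of symmetric functions, as the polynomial ring
  in the complete symmetric functions.  A monomial is a multiset of indices of generators; the
  index \<open>k\<close> stands for $h_{k+1}$, so that there is no superfluous generator for $h_0 = 1$.
\<close>

type_synonym symfun = "nat multiset \<Rightarrow>\<^sub>0 int"

definition complete_sym :: "int \<Rightarrow> symfun" where
  "complete_sym n =
     (if n < 0 then 0 else if n = 0 then 1 else Poly_Mapping.single {#nat (n - 1)#} 1)"

definition schur :: "partition \<Rightarrow> symfun" where
  "schur \<mu> =
     (let n = plength \<mu>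
      in det (mat n n (\<lambda>(i, j). complete_sym (int (part \<mu> (i + 1)) - int i + int j))))"

text \<open>
  The Hall inner product: the bilinear form on $\Lambda$ for which the Schur functions, which
  form a $\mathbb{Z}$-basis of $\Lambda$, are orthonormal.
\<close>

definition is_hall_product :: "(symfun \<Rightarrow> symfun \<Rightarrow> int) \<Rightarrow> bool" where
  "is_hall_product B \<longleftrightarrow>
     (\<forall>f g h. B (f + g) h = B f h + B g h) \<and>
     (\<forall>f g h. B f (g + h) = B f g + B f h) \<and>
     (\<forall>\<mu> \<nu>. B (schur \<mu>) (schur \<nu>) = (if \<mu> = \<nu> then 1 else 0))"

definition hall_product :: "symfun \<Rightarrow> symfun \<Rightarrow> int" where
  "hall_product = (THE B. is_hall_product B)"

definition skew_schur :: "partition \<Rightarrow> partition \<Rightarrow> symfun" where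
  "skew_schur \<mu> \<rho> =
     (THE f. \<forall>\<sigma>. hall_product f (schur \<sigma>) = hall_product (schur \<mu>) (schur \<rho> * schur \<sigma>))"

text \<open>The image of \<open>f\<close> under the ring homomorphism $\Lambda \to K$ with
  $h_n \mapsto$ \<open>\<eta> n\<close> for $n \ge 1$.\<close>

definition specialize :: "(nat \<Rightarrow> 'a::comm_ring_1) \<Rightarrow> symfun \<Rightarrow> 'a" where
  "specialize \<eta> f =
     (\<Sum>m \<in> Poly_Mapping.keys f. of_int (Poly_Mapping.lookup f m) * (\<Prod>k\<in>#m. \<eta> (Suc k)))"

text \<open>The value at $(1, q, q^2, \dots)$.\<close>

definition principal_value :: "'a::field \<Rightarrow> symfun \<Rightarrow> 'a" where
  "principal_value q = specialize (\<lambda>n. \<Prod>i = 1..n. inverse (1 - q ^ i))"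

text \<open>
  $s_\nu(\mathcal{E}(t)) = \det(e_{\nu'_i - i + j})$ for a power series
  $\mathcal{E}(t) = \sum_i e_i t^i$ with $e_0 = 1$.
\<close>

definition schur_fps :: "partition \<Rightarrow> 'a::comm_ring_1 fps \<Rightarrow> 'a" where
  "schur_fps \<nu> E =
     (let n = plength (conjugate \<nu>)
      in det (mat n n (\<lambda>(i, j).
           let k = int (part (conjugate \<nu>) (i + 1)) - int i + int j
           in if k < 0 then 0 else fps_nth E (nat k))))"


section \<open>The functions $\mathcal{W}_\mu$, $\mathcal{E}_\mu$ and $\mathcal{W}_{\mu,\nu}$\<close>

text \<open>
  Functions involving half-integral powers of $q$ take as argument a square root
  \<open>r\<close> $= q^{1/2}$.
\<close>

definition bracket :: "'a::field \<Rightarrow> int \<Rightarrow> 'a" where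
  "bracket r m = r powi m - r powi (- m)"

definition W1 :: "'a::field \<Rightarrow> partition \<Rightarrow> 'a" where
  "W1 r \<mu> =
     r powi (kappa \<mu> div 2) *
     (\<Prod>j = 1..plength \<mu>. \<Prod>i \<in> {1..<j}.
        bracket r (int (part \<mu> i) - int (part \<mu> j) + int j - int i) / bracket r (int j - int i)) *
     (\<Prod>i = 1..plength \<mu>. \<Prod>v = 1..part \<mu> i.
        1 / bracket r (int v - int i + int (plength \<mu>)))"

definition E_series :: "'a::field \<Rightarrow> partition \<Rightarrow> 'a fps" where
  "E_series q \<mu> =
     (\<Prod>j = 1..plength \<mu>.
        (1 + fps_const (q powi (int (part \<mu> j) - int j)) * fps_X) /
        (1 + fps_const (q powi (- int j)) * fps_X)) *
     (1 + Abs_fps (\<lambda>n. if n = 0 then 0 else 1 / (\<Prod>i = 1..n. (q ^ i - 1))))"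

definition W2 :: "'a::field \<Rightarrow> partition \<Rightarrow> partition \<Rightarrow> 'a" where
  "W2 r \<mu> \<nu> = r ^ psize \<nu> * W1 r \<mu> * schur_fps \<nu> (E_series (r\<^sup>2) \<mu>)"

end

theory Submission
  imports Defs
begin

text \<open>
  Skew Schur functions are identified with Jacobi-Trudi determinants as follows.  Let $h_r^\perp$
  be the coefficient of $u^r$ in the ring homomorphism $h_n \mapsto \sum_r h_{n-r} u^r$.  These
  operators commute, so $f \mapsto f^\perp$ makes sense, and the constant term of $f^\perp g$ is
  the Hall product.  On a product $h_{a_1} \cdots h_{a_n}$ the operator $f^\perp$ acts by
  $f(y_1, \dots, y_n)$, where $y_i$ lowers $a_i$ by one; the bialternant formula for $s_\rho(y)$
  thus yields $s_\rho^\perp s_\mu = \det(h_{\mu_i - \rho_j - i + j})$.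

  For the identity itself, truncate $\mathcal{E}_\mu$ to the $N$ variables $q^{\mu_j - j}$.  Then
  $s_\nu$ is a quotient of two minors of the matrix $(q^{ab})_{a, b}$.  The $q$-binomial theorem
  gives $q^{ab} = (q)_a (q)_b \sum_k d_k h_{a-k} h_{b-k}$ with $h_m = 1/(q)_m$, and the
  Cauchy-Binet formula turns a minor of this matrix into a sum over $\rho$ of
  $s_{\mu/\rho} s_{\nu/\rho}$ with explicit weights.  Both sides are rational functions of
  $z = q^{-N}$ which agree for infinitely many $z$; the theorem is the case $z = 0$.
\<close>

section \<open>Determinants\<close>

text \<open>The bialternant formula concerns finitely many variables, whereas
  \<open>E_series\<close> is a power series, and over an arbitrary field of characteristic zero
  there is no limit in N. Polynomial identity in z replaces the limit. It applies because N enters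
  the quotient of minors only through z: a ratio of q-factorials, rescaled by powers of q^(-N), is a
  product over boxes of factors z - q^content. The weights of \<rho> carry such factors in their
  denominators; a common denominator is cleared before polynomials are compared, and it vanishes
  neither at z = 0 nor at the points q^(-N) used.

  At z = 0 each box of \<nu> contributes -q^content, hence the sign and the power q^(\<kappa>/2),
  and each box of \<rho> contributes 1/q, hence q^(-|\<rho>|).

  The second identity also needs W_\<mu> in terms of s_\<mu>(1, q, ...). This comes from the same
  expansion with \<nu> empty, where the minor is a Vandermonde determinant.

  The Hall product and the skew Schur functions are definite descriptions, so existence and
  uniqueness are required: orthonormality is a computation with 0/1 determinants, spanning a
  triangularity argument.\<close>

definition detf :: "nat \<Rightarrow> (nat \<Rightarrow> nat \<Rightarrow> 'a::comm_ring_1) \<Rightarrow> 'a" where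
  "detf n f = det (mat n n (\<lambda>(i, j). f i j))"

lemma detf_altdef:
  "detf n f = (\<Sum>p | p permutes {..<n}. of_int (sign p) * (\<Prod>i<n. f i (p i)))"
proof -
  have "p permutes {..<n} \<Longrightarrow> i < n \<Longrightarrow> p i < n" for p i
    using permutes_in_image[of p "{..<n}" i] by simp
  then show ?thesis
    unfolding detf_def by (subst det_def'[of _ n]) (auto simp: atLeast0LessThan intro!: sum.cong prod.cong)
qed

lemma detf_cong: "(\<And>i j. i < n \<Longrightarrow> j < n \<Longrightarrow> f i j = g i j) \<Longrightarrow> detf n f = detf n g"
  unfolding detf_def by (intro arg_cong[of _ _ det] eq_matI) auto

lemma detf_0 [simp]: "detf 0 f = 1"
  by (simp add: detf_def)

lemma detf_mult: "detf n f * detf n g = detf n (\<lambda>i j. \<Sum>k<n. f i k * g k j)"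
proof -
  have "mat n n (\<lambda>(i, j). f i j) * mat n n (\<lambda>(i, j). g i j) =
      mat n n (\<lambda>(i, j). \<Sum>k<n. f i k * g k j)"
    by (intro eq_matI) (auto simp: scalar_prod_def atLeast0LessThan)
  then show ?thesis
    unfolding detf_def by (subst det_mult[symmetric, of _ n]) auto
qed

lemma detf_transpose: "detf n (\<lambda>i j. f j i) = detf n f"
proof -
  have "transpose_mat (mat n n (\<lambda>(i, j). f i j)) = mat n n (\<lambda>(i, j). f j i)"
    by (intro eq_matI) auto
  then show ?thesis
    unfolding detf_def using det_transpose[of "mat n n (\<lambda>(i, j). f i j)" n] by simp
qed

lemma detf_permute_rows:
  assumes "p permutes {..<n}"
  shows "detf n (\<lambda>i j. f (p i) j) = of_int (sign p) * detf n f"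
proof -
  have "p i < n" if "i < n" for i
    using permutes_in_image[OF assms, of i] that by simp
  then have "detf n (\<lambda>i j. f (p i) j) =
      det (mat n n (\<lambda>(i, j). mat n n (\<lambda>(i, j). f i j) $$ (p i, j)))"
    unfolding detf_def by (intro arg_cong[of _ _ det] eq_matI) auto
  also have "\<dots> = of_int (sign p) * detf n f"
    unfolding detf_def using assms by (subst det_permute_rows) (auto simp: atLeast0LessThan)
  finally show ?thesis .
qed

lemma detf_permute_cols:
  assumes "p permutes {..<n}"
  shows "detf n (\<lambda>i j. f i (p j)) = of_int (sign p) * detf n f"
proof -
  have "detf n (\<lambda>i j. f i (p j)) = detf n (\<lambda>i j. f j (p i))"
    by (rule detf_transpose[symmetric])
  also have "\<dots> = of_int (sign p) * detf n f"
    using detf_permute_rows[OF assms, of "\<lambda>i j. f j i"] detf_transpose[of n f] by metis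
  finally show ?thesis .
qed

lemma detf_identical_rows:
  assumes "i < n" "j < n" "i \<noteq> j" "\<And>k. k < n \<Longrightarrow> f i k = f j k"
  shows "detf n f = 0"
  unfolding detf_def
  by (rule det_identical_rows[of _ n i j]) (use assms in \<open>auto intro!: eq_vecI\<close>)

lemma detf_zero_row:
  assumes "i < n" "\<And>j. j < n \<Longrightarrow> f i j = 0"
  shows "detf n f = 0"
proof -
  have "(\<Prod>k<n. f k (p k)) = 0" if "p permutes {..<n}" for p
    using assms permutes_in_image[OF that, of i] by (intro prod_zero) auto
  then show ?thesis
    by (simp add: detf_altdef)
qed

lemma detf_zero_col:
  assumes "j < n" "\<And>i. i < n \<Longrightarrow> f i j = 0"
  shows "detf n f = 0"
proof -
  have "detf n (\<lambda>i j. f j i) = 0"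
    using assms by (intro detf_zero_row) auto
  then show ?thesis
    using detf_transpose[of n f] by metis
qed

lemma detf_scale_rows: "detf n (\<lambda>i j. c i * f i j) = (\<Prod>i<n. c i) * detf n f"
  by (simp add: detf_altdef sum_distrib_left prod.distrib mult_ac)

lemma detf_scale_cols: "detf n (\<lambda>i j. c j * f i j) = (\<Prod>j<n. c j) * detf n f"
proof -
  have "detf n (\<lambda>i j. c j * f i j) = detf n (\<lambda>i j. c i * f j i)"
    by (rule detf_transpose[symmetric])
  also have "\<dots> = (\<Prod>j<n. c j) * detf n f"
    using detf_scale_rows[of n c "\<lambda>i j. f j i"] detf_transpose[of n f] by metis
  finally show ?thesis .
qed

lemma detf_upper_triangular:
  assumes "\<And>i j. j < i \<Longrightarrow> i < n \<Longrightarrow> f i j = 0"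
  shows "detf n f = (\<Prod>i<n. f i i)"
proof -
  have "detf n f = prod_list (diag_mat (mat n n (\<lambda>(i, j). f i j)))"
    unfolding detf_def by (rule det_upper_triangular[of _ n]) (use assms in auto)
  also have "\<dots> = (\<Prod>i<n. f i i)"
    using prod.distinct_set_conv_list[of "[0..<n]" "\<lambda>i. f i i"]
    by (simp add: diag_mat_def atLeast0LessThan) (intro arg_cong[of _ _ prod_list] map_cong; simp)
  finally show ?thesis .
qed

lemma detf_lower_triangular:
  assumes "\<And>i j. i < j \<Longrightarrow> j < n \<Longrightarrow> f i j = 0"
  shows "detf n f = (\<Prod>i<n. f i i)"
proof -
  have "detf n (\<lambda>i j. f j i) = (\<Prod>i<n. f i i)"
    using assms by (intro detf_upper_triangular) auto
  then show ?thesis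
    using detf_transpose[of n f] by metis
qed

lemma (in comm_ring_hom) hom_detf: "hom (detf n f) = detf n (\<lambda>i j. hom (f i j))"
proof -
  have "map_mat hom (mat n n (\<lambda>(i, j). f i j)) = mat n n (\<lambda>(i, j). hom (f i j))"
    by (intro eq_matI) auto
  then show ?thesis
    unfolding detf_def hom_det[symmetric] by simp
qed

text \<open>Laplace expansion along the last row. It allows Jacobi-Trudi determinants to be padded
  by zero parts, so that several partitions share one matrix size.\<close>

lemma detf_Suc:
  assumes "\<And>j. j < n \<Longrightarrow> f n j = 0"
  shows "detf (Suc n) f = detf n f * f n n"
proof -
  let ?A = "mat (Suc n) (Suc n) (\<lambda>(i, j). f i j)"
  have "det ?A = (\<Sum>j<Suc n. ?A $$ (n, j) * cofactor ?A n j)"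
    by (rule laplace_expansion_row) auto
  also have "\<dots> = f n n * cofactor ?A n n"
    using assms by simp
  also have "mat_delete ?A n n = mat n n (\<lambda>(i, j). f i j)"
    by (intro eq_matI) (auto simp: mat_delete_def)
  then have "cofactor ?A n n = detf n f"
    by (simp add: cofactor_def detf_def)
  finally show ?thesis
    by (simp add: detf_def mult.commute)
qed

lemma detf_lower_left_zero:
  fixes f :: "nat \<Rightarrow> nat \<Rightarrow> 'a::idom"
  assumes "\<And>i j. n \<le> i \<Longrightarrow> i < n + m \<Longrightarrow> j < n \<Longrightarrow> f i j = 0"
  shows "detf (n + m) f = detf n f * detf m (\<lambda>i j. f (n + i) (n + j))"
proof -
  have "mat (n + m) (n + m) (\<lambda>(i, j). f i j) =
      four_block_mat (mat n n (\<lambda>(i, j). f i j)) (mat n m (\<lambda>(i, j). f i (n + j)))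
        (0\<^sub>m m n) (mat m m (\<lambda>(i, j). f (n + i) (n + j)))"
    by (intro eq_matI) (auto simp: assms)
  then show ?thesis
    unfolding detf_def by (simp add: det_four_block_mat_lower_left_zero[of _ n _ m])
qed

lemma detf_upper_right_zero:
  fixes f :: "nat \<Rightarrow> nat \<Rightarrow> 'a::idom"
  assumes "\<And>i j. n \<le> j \<Longrightarrow> j < n + m \<Longrightarrow> i < n \<Longrightarrow> f i j = 0"
  shows "detf (n + m) f = detf n f * detf m (\<lambda>i j. f (n + i) (n + j))"
proof -
  have "detf (n + m) (\<lambda>i j. f j i) = detf n (\<lambda>i j. f j i) * detf m (\<lambda>i j. f (n + j) (n + i))"
    by (rule detf_lower_left_zero) (use assms in auto)
  also have "detf m (\<lambda>i j. f (n + j) (n + i)) = detf m (\<lambda>i j. f (n + i) (n + j))"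
    by (rule detf_transpose)
  finally show ?thesis
    using detf_transpose[of "n + m" f] detf_transpose[of n f] by metis
qed

text \<open>A unitriangular change of basis from monomials to the Newton polynomials
  \<open>P k\<close> makes the matrix triangular, because \<open>P j\<close> vanishes at x_i for i <
  j.\<close>

lemma detf_vandermonde: "detf n (\<lambda>i j. x i ^ j) = (\<Prod>i<n. \<Prod>j<i. x i - x j)"
proof -
  define P where "P k = (\<Prod>l<k. [:- x l, 1:])" for k
  have P_Suc: "P (Suc k) = pCons 0 (P k) - smult (x k) (P k)" for k
    by (simp add: P_def)
  have monic: "coeff (P k) k = 1" and high: "\<And>j. k < j \<Longrightarrow> coeff (P k) j = 0" for k
  proof (induction k)
    case (Suc k)
    { case 1 show ?case using Suc by (simp add: P_Suc) }
    { case 2 then show ?case using Suc by (auto simp: P_Suc coeff_pCons split: nat.splits) }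
  qed (auto simp: P_def coeff_1)
  have poly_P: "poly (P k) t = (\<Prod>l<k. t - x l)" for k t
    by (simp add: P_def poly_prod)
  have "detf n (\<lambda>i j. x i ^ j) * detf n (\<lambda>k j. coeff (P j) k) =
      detf n (\<lambda>i j. poly (P j) (x i))"
    unfolding detf_mult
  proof (rule detf_cong)
    fix i j assume "i < n" "j < n"
    have "degree (P j) \<le> j"
      using high by (intro degree_le) auto
    then have "poly (P j) (x i) = (\<Sum>k<n. coeff (P j) k * x i ^ k)"
      using \<open>j < n\<close> unfolding poly_altdef
      by (intro sum.mono_neutral_left) (auto intro: le_degree)
    then show "(\<Sum>k<n. x i ^ k * coeff (P j) k) = poly (P j) (x i)"
      by (simp add: mult.commute)
  qed
  moreover have "detf n (\<lambda>k j. coeff (P j) k) = 1"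
    by (subst detf_upper_triangular) (use monic high in auto)
  moreover have "detf n (\<lambda>i j. poly (P j) (x i)) = (\<Prod>i<n. \<Prod>j<i. x i - x j)"
    by (subst detf_lower_triangular) (auto simp: poly_P intro!: prod_zero)
  ultimately show ?thesis
    by simp
qed

text \<open>The n-subsets are parametrized by an arbitrary set \<open>S\<close>, so that partitions
  can serve as indices directly. Expanding the rows gives a sum over all maps from {..<n} to {..<m};
  non-injective maps contribute determinants with equal rows, and each injective one is uniquely an
  enumeration \<open>k s\<close> preceded by a permutation.\<close>

lemma cauchy_binet:
  fixes A B :: "nat \<Rightarrow> nat \<Rightarrow> 'a::comm_ring_1"
  assumes inj: "\<And>s. s \<in> S \<Longrightarrow> inj_on (k s) {..<n}"
    and bij: "bij_betw (\<lambda>s. k s ` {..<n}) S {K. K \<subseteq> {..<m} \<and> card K = n}"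
  shows "detf n (\<lambda>i j. \<Sum>l<m. A i l * B l j) =
    (\<Sum>s\<in>S. detf n (\<lambda>i j. A i (k s j)) * detf n (\<lambda>i j. B (k s i) j))"
proof -
  let ?P = "{p. p permutes {..<n}}" and ?F = "PiE {..<n} (\<lambda>_. {..<m})"
  let ?I = "{f \<in> ?F. inj_on f {..<n}}"
  let ?g = "\<lambda>f. (\<Prod>i<n. A i (f i)) * detf n (\<lambda>i j. B (f i) j)"
  have finF: "finite ?F"
    by (intro finite_PiE) auto
  have "finite S"
    using bij_betw_finite[OF bij] by simp
  have p_less: "p i < n" if "p permutes {..<n}" "i < n" for p i
    using permutes_in_image[OF that(1), of i] that by simp
  have "detf n (\<lambda>i j. \<Sum>l<m. A i l * B l j) =
      (\<Sum>p\<in>?P. \<Sum>f\<in>?F. of_int (sign p) * (\<Prod>i<n. A i (f i) * B (f i) (p i)))"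
    unfolding detf_altdef by (subst prod_sum_PiE) (auto simp: sum_distrib_left)
  also have "\<dots> = (\<Sum>f\<in>?F. ?g f)"
    by (subst sum.swap) (simp add: detf_altdef sum_distrib_left prod.distrib mult_ac)
  also have "\<dots> = (\<Sum>f\<in>?I. ?g f)"
  proof (intro sum.mono_neutral_right ballI)
    fix f assume "f \<in> ?F - ?I"
    then obtain i j where "i < n" "j < n" "i \<noteq> j" "f i = f j"
      by (auto simp: inj_on_def)
    then have "detf n (\<lambda>i j. B (f i) j) = 0"
      by (intro detf_identical_rows[of i n j]) auto
    then show "?g f = 0"
      by simp
  qed (use finF in auto)
  also have "\<dots> = (\<Sum>(s, p)\<in>S \<times> ?P. ?g (restrict (k s \<circ> p) {..<n}))"
  proof -
    have "bij_betw (\<lambda>(s, p). restrict (k s \<circ> p) {..<n}) (S \<times> ?P) ?I"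
      unfolding bij_betw_def
    proof (intro conjI inj_onI)
      fix sp sp' assume "sp \<in> S \<times> ?P" "sp' \<in> S \<times> ?P" and
        "(\<lambda>(s, p). restrict (k s \<circ> p) {..<n}) sp = (\<lambda>(s, p). restrict (k s \<circ> p) {..<n}) sp'"
      then obtain s p s' p' where sp: "sp = (s, p)" "sp' = (s', p')"
        and s: "s \<in> S" "s' \<in> S" and p: "p permutes {..<n}" "p' permutes {..<n}"
        and eq: "restrict (k s \<circ> p) {..<n} = restrict (k s' \<circ> p') {..<n}"
        by auto
      have "k s ` p ` {..<n} = k s' ` p' ` {..<n}"
        using arg_cong[OF eq, of "\<lambda>f. f ` {..<n}"] by (simp add: image_image)
      then have "k s ` {..<n} = k s' ` {..<n}"
        by (simp add: permutes_image[OF p(1)] permutes_image[OF p(2)])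
      then have "s = s'"
        using bij s by (auto simp: bij_betw_def dest: inj_onD)
      moreover have "p i = p' i" for i
      proof (cases "i < n")
        case True
        then have "k s (p i) = k s (p' i)"
          using fun_cong[OF eq, of i] \<open>s = s'\<close> by simp
        then show ?thesis
          using inj[OF s(1)] p_less[OF p(1) True] p_less[OF p(2) True] by (auto dest: inj_onD)
      next
        case False
        then show ?thesis
          using p by (simp add: permutes_def)
      qed
      ultimately show "sp = sp'"
        by (auto simp: sp)
    next
      show "(\<lambda>(s, p). restrict (k s \<circ> p) {..<n}) ` (S \<times> ?P) = ?I"
      proof (intro equalityI subsetI)
        fix f assume "f \<in> (\<lambda>(s, p). restrict (k s \<circ> p) {..<n}) ` (S \<times> ?P)"
        then obtain s p where s: "s \<in> S" and p: "p permutes {..<n}"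
          and f: "f = restrict (k s \<circ> p) {..<n}"
          by auto
        have "k s ` {..<n} \<subseteq> {..<m}"
          using bij_betwE[OF bij] s by blast
        moreover have "inj_on (k s \<circ> p) {..<n}"
          using inj[OF s] permutes_image[OF p]
          by (intro comp_inj_on) (auto intro: permutes_inj_on[OF p])
        ultimately show "f \<in> ?I"
          using p_less[OF p] by (auto simp: f inj_on_restrict_eq image_subset_iff)
      next
        fix f assume f: "f \<in> ?I"
        then have "f ` {..<n} \<in> {K. K \<subseteq> {..<m} \<and> card K = n}"
          by (auto simp: card_image)
        then have "f ` {..<n} \<in> (\<lambda>s. k s ` {..<n}) ` S"
          by (simp only: bij_betw_imp_surj_on[OF bij])
        then obtain s where s: "s \<in> S" and im: "f ` {..<n} = k s ` {..<n}"
          by (rule imageE)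
        \<comment> \<open>The permutation is f read in the enumeration \<open>k s\<close> of its
          image; outside {..<n} it has to be the identity.\<close>
        define p where "p i = (if i < n then inv_into {..<n} (k s) (f i) else i)" for i
        have kp: "k s (p i) = f i" and pn: "p i < n" if "i < n" for i
        proof -
          have fi: "f i \<in> k s ` {..<n}"
            using that im by blast
          show "k s (p i) = f i"
            using f_inv_into_f[OF fi] that by (simp add: p_def)
          show "p i < n"
            using inv_into_into[OF fi] that by (simp add: p_def)
        qed
        have inj_p: "inj_on p {..<n}"
        proof (rule inj_onI)
          fix i j assume "i \<in> {..<n}" "j \<in> {..<n}" "p i = p j"
          then show "i = j"
            using kp[of i] kp[of j] f by (auto dest: inj_onD)
        qed
        have "p ` {..<n} = {..<n}"
          using pn by (intro endo_inj_surj inj_p) auto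
        then have "p permutes {..<n}"
          using inj_p by (intro bij_imp_permutes) (auto simp: bij_betw_def p_def)
        moreover have "f = restrict (k s \<circ> p) {..<n}"
          using f kp by (auto simp: fun_eq_iff restrict_def PiE_iff extensional_def)
        ultimately show "f \<in> (\<lambda>(s, p). restrict (k s \<circ> p) {..<n}) ` (S \<times> ?P)"
          using s by auto
      qed
    qed
    from sum.reindex_bij_betw[OF this, of ?g] show ?thesis
      by (simp add: case_prod_unfold)
  qed
  also have "\<dots> = (\<Sum>s\<in>S. \<Sum>p\<in>?P. ?g (k s \<circ> p))"
  proof -
    have "?g (restrict (k s \<circ> p) {..<n}) = ?g (k s \<circ> p)" for s p
      by (intro arg_cong2[of _ _ _ _ "(*)"] detf_cong prod.cong) auto
    then show ?thesis
      by (simp add: sum.cartesian_product)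
  qed
  also have "\<dots> = (\<Sum>s\<in>S. detf n (\<lambda>i j. A i (k s j)) * detf n (\<lambda>i j. B (k s i) j))"
  proof (intro sum.cong refl)
    fix s
    have "(\<Sum>p\<in>?P. ?g (k s \<circ> p)) = (\<Sum>p\<in>?P. of_int (sign p) *
        (\<Prod>i<n. A i (k s (p i))) * detf n (\<lambda>i j. B (k s i) j))"
      using detf_permute_rows[of _ n "\<lambda>i j. B (k s i) j"]
      by (intro sum.cong) (auto simp: mult_ac)
    then show "(\<Sum>p\<in>?P. ?g (k s \<circ> p)) =
        detf n (\<lambda>i j. A i (k s j)) * detf n (\<lambda>i j. B (k s i) j)"
      by (simp add: detf_altdef[of n "\<lambda>i j. A i (k s j)"] sum_distrib_right)
  qed
  finally show ?thesis .
qed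

text \<open>Permuting the rows of the Vandermonde matrix at 0, ..., n-1 multiplies the determinant
  by \<open>sign p\<close>; comparing signs of the two integer products counts inversions.\<close>

lemma sign_eq_prod_sgn:
  assumes "p permutes {..<n}"
  shows "sign p = (\<Prod>i<n. \<Prod>j<i. sgn (int (p i) - int (p j)))"
proof -
  have "(\<Prod>i<n. \<Prod>j<i. int (p i) - int (p j)) = sign p * (\<Prod>i<n. \<Prod>j<i. int i - int j)"
    using detf_permute_rows[OF assms, of "\<lambda>i j. int i ^ j"] by (simp add: detf_vandermonde)
  then have "sgn (\<Prod>i<n. \<Prod>j<i. int (p i) - int (p j)) =
      sgn (sign p) * sgn (\<Prod>i<n. \<Prod>j<i. int i - int j)"
    by (simp only: sgn_mult)
  moreover have sgn_prod: "sgn (\<Prod>i\<in>A. f i) = (\<Prod>i\<in>A. sgn (f i))" for A and f :: "nat \<Rightarrow> int"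
    by (induction A rule: infinite_finite_induct) (auto simp: sgn_mult)
  ultimately have "(\<Prod>i<n. \<Prod>j<i. sgn (int (p i) - int (p j))) =
      sgn (sign p) * (\<Prod>i<n. \<Prod>j<i. sgn (int i - int j))"
    by (simp only: sgn_prod)
  also have "(\<Prod>i<n. \<Prod>j<i. sgn (int i - int j)) = 1"
    by (intro prod.neutral ballI) auto
  finally show ?thesis
    by (simp add: sign_def)
qed

lemma prod_lessThan_add:
  fixes g :: "nat \<Rightarrow> 'a::comm_monoid_mult"
  shows "prod g {..<n + m} = prod g {..<n} * (\<Prod>j<m. g (n + j))"
  by (induction m) (auto simp: mult_ac)

text \<open>As p is weakly decreasing, an index in the set brings all smaller ones with it. For
  column lengths of a Young diagram this is the duality between a partition and its
  conjugate.\<close>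

lemma initial_segment_card:
  fixes p :: "nat \<Rightarrow> nat"
  assumes "\<And>i i'. i \<le> i' \<Longrightarrow> p i' \<le> p i"
  shows "{i \<in> {..<N}. j < p i} = {..<card {i \<in> {..<N}. j < p i}}"
proof (induction N)
  case (Suc N)
  show ?case
  proof (cases "j < p N")
    case True
    then have "{i \<in> {..<Suc N}. j < p i} = {..<Suc N}"
      using assms by (auto simp: less_Suc_eq_le) (meson less_le_trans)
    then show ?thesis
      by simp
  next
    case False
    then have "{i \<in> {..<Suc N}. j < p i} = {i \<in> {..<N}. j < p i}"
      by (auto simp: less_Suc_eq)
    then show ?thesis
      using Suc by metis
  qed
qed auto

section \<open>Homomorphisms of the ring of symmetric functions\<close>

text \<open>One construction behind \<open>specialize\<close>, \<open>perp\<close> and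
  \<open>shift_map\<close>, which differ only in their values on monomials.\<close>

definition linear_ext :: "('k \<Rightarrow> 'a::comm_ring_1) \<Rightarrow> ('k \<Rightarrow>\<^sub>0 int) \<Rightarrow> 'a" where
  "linear_ext \<phi> f = (\<Sum>m\<in>Poly_Mapping.keys f. of_int (Poly_Mapping.lookup f m) * \<phi> m)"

lemma linear_ext_superset:
  assumes "finite S" "Poly_Mapping.keys f \<subseteq> S"
  shows "linear_ext \<phi> f = (\<Sum>m\<in>S. of_int (Poly_Mapping.lookup f m) * \<phi> m)"
  unfolding linear_ext_def using assms
  by (intro sum.mono_neutral_left) (auto simp: in_keys_iff)

lemma linear_ext_add: "linear_ext \<phi> (f + g) = linear_ext \<phi> f + linear_ext \<phi> g"
proof -
  let ?S = "Poly_Mapping.keys f \<union> Poly_Mapping.keys g"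
  have "linear_ext \<phi> (f + g) = (\<Sum>m\<in>?S. of_int (Poly_Mapping.lookup (f + g) m) * \<phi> m)"
    by (intro linear_ext_superset Poly_Mapping.keys_add) auto
  then show ?thesis
    by (simp add: linear_ext_superset[of ?S f] linear_ext_superset[of ?S g] lookup_add
          ring_distribs sum.distrib)
qed

lemma linear_ext_single [simp]: "linear_ext \<phi> (Poly_Mapping.single m c) = of_int c * \<phi> m"
  by (simp add: linear_ext_def)

lemma linear_ext_0 [simp]: "linear_ext \<phi> 0 = 0"
  by (simp add: linear_ext_def)

lemma linear_ext_uminus: "linear_ext \<phi> (- f) = - linear_ext \<phi> f"
  using linear_ext_add[of \<phi> f "- f"] by (simp add: add_eq_0_iff2)

lemma linear_ext_sum: "linear_ext \<phi> (sum f A) = (\<Sum>x\<in>A. linear_ext \<phi> (f x))"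
  by (induction A rule: infinite_finite_induct) (auto simp: linear_ext_add)

lemma poly_mapping_single_induct [case_names single add]:
  fixes f :: "'k \<Rightarrow>\<^sub>0 'b::comm_monoid_add"
  assumes single: "\<And>m c. P (Poly_Mapping.single m c)"
    and add: "\<And>f g. P f \<Longrightarrow> P g \<Longrightarrow> P (f + g)"
  shows "P f"
proof -
  have "f = (\<Sum>m\<in>Poly_Mapping.keys f. Poly_Mapping.single m (Poly_Mapping.lookup f m))"
    by (intro poly_mapping_eqI)
      (simp add: lookup_sum lookup_single when_def in_keys_iff)
  moreover have "P (\<Sum>m\<in>A. Poly_Mapping.single m (c m))" for A c
    using single[of undefined 0]
    by (induction A rule: infinite_finite_induct) (auto intro: single add)
  ultimately show ?thesis
    by metis
qed

lemma specialize_eq_linear_ext: "specialize \<eta> = linear_ext (\<lambda>m. \<Prod>k\<in>#m. \<eta> (Suc k))"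
  by (auto simp: specialize_def linear_ext_def fun_eq_iff)

lemma specialize_mult: "specialize \<eta> (f * g) = specialize \<eta> f * specialize \<eta> g"
proof (induction f rule: poly_mapping_single_induct)
  case (single m c)
  show ?case
  proof (induction g rule: poly_mapping_single_induct)
    case (single m' c')
    show ?case
      by (simp add: specialize_eq_linear_ext mult_single mult_ac)
  qed (simp add: specialize_eq_linear_ext linear_ext_add ring_distribs)
qed (simp add: specialize_eq_linear_ext linear_ext_add ring_distribs)

interpretation specialize: comm_ring_hom "specialize \<eta>" for \<eta> :: "nat \<Rightarrow> 'a::comm_ring_1"
proof
  have "specialize \<eta> (Poly_Mapping.single 0 1) = 1"
    by (simp add: specialize_eq_linear_ext del: single_one)
  then show "specialize \<eta> 1 = 1"
    by simp
qed (auto simp: specialize_mult, auto simp: specialize_eq_linear_ext linear_ext_add)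

lemma specialize_complete_sym:
  "specialize \<eta> (complete_sym n) = (if n < 0 then 0 else if n = 0 then 1 else \<eta> (nat n))"
  by (auto simp: complete_sym_def specialize_eq_linear_ext Suc_nat_eq_nat_zadd1 simp flip: single_one)

lemma complete_sym_simps [simp]: "n < 0 \<Longrightarrow> complete_sym n = 0" "complete_sym 0 = 1"
  by (auto simp: complete_sym_def)

lemma single_add_mset:
  "(Poly_Mapping.single (add_mset k m) c :: symfun) =
    complete_sym (int (Suc k)) * Poly_Mapping.single m c"
  by (simp add: complete_sym_def mult_single)

text \<open>The complete symmetric functions generate the ring: integers are built from 1 by
  addition and negation, monomials by adjoining one generator at a time. Identities between
  operators thus need checking on generators only.\<close>

lemma symfun_ring_induct [case_names one gen add uminus mult]:
  assumes one: "P 1" and gen: "\<And>k. P (complete_sym (int (Suc k)))"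
    and add: "\<And>f g. P f \<Longrightarrow> P g \<Longrightarrow> P (f + g)"
    and uminus: "\<And>f. P f \<Longrightarrow> P (- f)"
    and mult: "\<And>f g. P f \<Longrightarrow> P g \<Longrightarrow> P (f * g)"
  shows "P (f :: symfun)"
proof (induction f rule: poly_mapping_single_induct)
  case (single m c)
  show ?case
  proof (induction m)
    case empty
    have "P 0"
      using add[OF one uminus[OF one]] by simp
    then have "P (of_nat n)" for n
      by (induction n) (auto intro: add one)
    then have "P (of_int c)"
      by (cases c rule: int_cases2) (auto intro: uminus)
    then show ?case
      by (simp flip: single_of_int)
  next
    case (add k m)
    then show ?case
      unfolding single_add_mset by (intro mult gen)
  qed
qed (rule add)

text \<open>In terms of variables this adjoins one variable u, sending f(x_1, x_2, ...) to f(u, x_1,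
  x_2, ...), since h_n(u, x) is the sum of the u^k h_(n-k)(x).\<close>

definition lower_gf :: "symfun \<Rightarrow> symfun fps" where
  "lower_gf = specialize (\<lambda>n. Abs_fps (\<lambda>k. complete_sym (int n - int k)))"

definition lower :: "nat \<Rightarrow> symfun \<Rightarrow> symfun" where
  "lower r f = fps_nth (lower_gf f) r"

interpretation lower_gf: comm_ring_hom lower_gf
  unfolding lower_gf_def by (rule specialize.comm_ring_hom_axioms)

lemma lower_gf_complete_sym:
  "lower_gf (complete_sym n) = Abs_fps (\<lambda>k. complete_sym (n - int k))"
  by (auto simp: lower_gf_def specialize_complete_sym fps_eq_iff)

lemma lower_complete_sym: "lower r (complete_sym n) = complete_sym (n - int r)"
  by (simp add: lower_def lower_gf_complete_sym)

lemma lower_1: "lower r 1 = (if r = 0 then 1 else 0)"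
  by (simp add: lower_def lower_gf.hom_one)

lemma lower_add: "lower r (f + g) = lower r f + lower r g"
  by (simp add: lower_def lower_gf.hom_add)

lemma lower_uminus: "lower r (- f) = - lower r f"
  by (simp add: lower_def lower_gf.hom_uminus)

lemma lower_zero [simp]: "lower r 0 = 0"
  using lower_add[of r 0 0] by simp

lemma lower_sum: "lower r (sum f A) = (\<Sum>x\<in>A. lower r (f x))"
  by (induction A rule: infinite_finite_induct) (auto simp: lower_add)

lemma lower_mult: "lower r (f * g) = (\<Sum>i\<le>r. lower i f * lower (r - i) g)"
  by (simp add: lower_def lower_gf.hom_mult fps_mult_nth atLeast0AtMost)

lemma lower_of_int_mult: "lower r (of_int c * f) = of_int c * lower r f"
proof -
  have "lower r (of_nat n * f) = of_nat n * lower r f" for n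
    by (induction n) (auto simp: lower_add ring_distribs)
  then show ?thesis
    by (cases c rule: int_cases2) (auto simp: lower_uminus)
qed

lemma lower_0: "lower 0 f = f"
  by (induction f rule: symfun_ring_induct)
    (auto simp: lower_1 lower_complete_sym lower_add lower_uminus lower_mult)

text \<open>Both orders of composition obey the same product rule, so generators suffice, and there
  either order gives h_(n-r-s). Commutation is what makes the fold over a multiset in
  \<open>perp\<close> follow its recursion.\<close>

lemma lower_commute: "lower r (lower s f) = lower s (lower r f)"
proof (induction f arbitrary: r s rule: symfun_ring_induct)
  case (mult f g)
  have "lower r (lower s (f * g)) = (\<Sum>j\<le>s. \<Sum>i\<le>r.
      lower i (lower j f) * lower (r - i) (lower (s - j) g))" for r s
    by (simp add: lower_mult lower_sum)
  also have "\<dots> r s = (\<Sum>i\<le>r. \<Sum>j\<le>s.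
      lower j (lower i f) * lower (s - j) (lower (r - i) g))" for r s
    by (subst sum.swap) (simp add: mult)
  finally show ?case
    by (simp add: lower_mult lower_sum)
qed (auto simp: lower_1 lower_complete_sym lower_add lower_uminus add_ac diff_diff_eq)

interpretation lower: comp_fun_commute "\<lambda>k. lower (Suc k)"
  by standard (auto simp: fun_eq_iff lower_commute)

text \<open>The adjoint of multiplication by \<open>f\<close> for the Hall inner product.\<close>

definition perp :: "symfun \<Rightarrow> symfun \<Rightarrow> symfun" where
  "perp f g = linear_ext (fold_mset (\<lambda>k. lower (Suc k)) g) f"

lemma perp_add_left: "perp (f + f') g = perp f g + perp f' g"
  by (simp add: perp_def linear_ext_add)

lemma perp_uminus_left: "perp (- f) g = - perp f g"
  by (simp add: perp_def linear_ext_uminus)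

lemma perp_1: "perp 1 g = g"
proof -
  have "perp (Poly_Mapping.single 0 1) g = g"
    by (simp add: perp_def del: single_one)
  then show ?thesis
    by simp
qed

lemma perp_complete_sym: "0 \<le> n \<Longrightarrow> perp (complete_sym n) g = lower (nat n) g"
  by (auto simp: complete_sym_def perp_1 lower_0) (simp add: perp_def Suc_nat_eq_nat_zadd1)

lemma perp_add_right: "perp f (g + g') = perp f g + perp f g'"
proof -
  have "fold_mset (\<lambda>k. lower (Suc k)) (g + g') m =
      fold_mset (\<lambda>k. lower (Suc k)) g m + fold_mset (\<lambda>k. lower (Suc k)) g' m" for m
    by (induction m) (auto simp: lower_add)
  then show ?thesis
    by (simp add: perp_def linear_ext_def ring_distribs sum.distrib)
qed

text \<open>On monomials \<open>perp\<close> composes lowering operators, and a union of multisets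
  composes the folds. Followed by the constant term, this says that \<open>perp f\<close> is adjoint
  to multiplication by f.\<close>

lemma perp_mult: "perp (f * f') g = perp f (perp f' g)"
proof (induction f rule: poly_mapping_single_induct)
  case (single m c)
  show ?case
  proof (induction f' rule: poly_mapping_single_induct)
    case (single m' c')
    have scale: "fold_mset (\<lambda>k. lower (Suc k)) (of_int c' * h) m =
        of_int c' * fold_mset (\<lambda>k. lower (Suc k)) h m" for h
      by (induction m) (auto simp: lower_of_int_mult)
    then show ?case
      by (simp add: perp_def mult_single lower.fold_mset_union scale mult.assoc
          add.commute[of m m'])
  qed (simp add: perp_add_left perp_add_right ring_distribs)
qed (simp add: perp_add_left perp_add_right ring_distribs)

section \<open>The Jacobi-Trudi identity\<close>

lemma part_0: "plength \<mu> < i \<Longrightarrow> part \<mu> i = 0"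
  by (simp add: part_def plength_def)

lemma part_pos_iff: "1 \<le> i \<Longrightarrow> 0 < part \<mu> i \<longleftrightarrow> i \<le> plength \<mu>"
proof -
  assume "1 \<le> i"
  moreover have "0 \<notin> set (parts \<mu>)"
    using parts[of \<mu>] by auto
  then have "parts \<mu> ! (i - 1) \<noteq> 0" if "i - 1 < length (parts \<mu>)"
    using that by (metis nth_mem)
  ultimately show ?thesis
    by (auto simp: part_def plength_def)
qed

lemma part_antimono:
  assumes "1 \<le> i" "i \<le> j"
  shows "part \<mu> j \<le> part \<mu> i"
proof -
  have "sorted_wrt (\<ge>) (parts \<mu>)"
    using parts[of \<mu>] by auto
  then have "parts \<mu> ! (j - 1) \<le> parts \<mu> ! (i - 1)" if "i < j" "j - 1 < length (parts \<mu>)"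
    using that assms by (auto simp: sorted_wrt_iff_nth_less)
  then show ?thesis
    using assms by (cases "i = j") (auto simp: part_def)
qed

lemma partition_eqI:
  assumes "\<And>i. 1 \<le> i \<Longrightarrow> part \<mu> i = part \<nu> i"
  shows "\<mu> = \<nu>"
proof -
  have "i \<le> plength \<mu> \<longleftrightarrow> i \<le> plength \<nu>" if "1 \<le> i" for i
    using assms[OF that] part_pos_iff[OF that] by metis
  then have len: "plength \<mu> = plength \<nu>"
    by (metis le_antisym le_refl nat_le_linear not_less_eq_eq One_nat_def le0 le_Suc_eq)
  have "parts \<mu> = parts \<nu>"
  proof (rule nth_equalityI)
    fix i assume "i < length (parts \<mu>)"
    then show "parts \<mu> ! i = parts \<nu> ! i"
      using assms[of "Suc i"] len by (simp add: part_def plength_def)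
  qed (use len in \<open>simp add: plength_def\<close>)
  then show ?thesis
    by (simp add: parts_inject)
qed

lemma fps_nth_0_prod: "fps_nth (prod f A) 0 = (\<Prod>x\<in>A. fps_nth (f x) 0)"
  by (induction A rule: infinite_finite_induct) auto

text \<open>The coefficient is the elementary symmetric polynomial e_r in fewer than r
  variables.\<close>

lemma fps_nth_prod_linear_eq_0:
  fixes x :: "nat \<Rightarrow> 'a::comm_ring_1"
  assumes "finite A" "card A < r"
  shows "fps_nth (\<Prod>i\<in>A. 1 + fps_const (x i) * fps_X) r = 0"
  using assms
proof (induction A arbitrary: r)
  case (insert i A)
  then show ?case
    by (cases r) (auto simp: ring_distribs mult.assoc)
qed auto

text \<open>The complete symmetric polynomial h_r(y_0, ..., y_(n-1)), through its generating
  function, the product of the geometric series 1/(1 - y_i X).\<close>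

definition hsum :: "nat \<Rightarrow> (nat \<Rightarrow> 'a::comm_ring_1) \<Rightarrow> nat \<Rightarrow> 'a" where
  "hsum n y r = fps_nth (\<Prod>i<n. Abs_fps (\<lambda>k. y i ^ k)) r"

text \<open>Let H be the product of all 1/(1 - y_l X) and \<open>G i\<close> that of the 1 - y_l X
  with l \<noteq> i. Then H times \<open>G i\<close> is 1/(1 - y_i X), and comparing coefficients
  factors the alternant into a matrix independent of p and the Jacobi-Trudi matrix. Nothing is
  divided, so the polynomial ring \<open>symfun\<close> is covered.\<close>

lemma jacobi_trudi:
  fixes y :: "nat \<Rightarrow> 'a::comm_ring_1" and p :: "nat \<Rightarrow> nat"
  shows "detf n (\<lambda>i j. y i ^ (p j + (n - 1 - j))) =
    detf n (\<lambda>i j. let k = int (p i) - int i + int j in if k < 0 then 0 else hsum n y (nat k)) *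
    detf n (\<lambda>i j. y i ^ (n - 1 - j))"
proof -
  define h where "h k = (if k < 0 then 0 else hsum n y (nat k))" for k :: int
  define \<Gamma> where "\<Gamma> i = Abs_fps (\<lambda>k. y i ^ k)" for i
  define G where "G i = (\<Prod>l\<in>{..<n} - {i}. 1 + fps_const (- y l) * fps_X)" for i
  have \<Gamma>_inv: "\<Gamma> i * (1 + fps_const (- y i) * fps_X) = 1" for i
  proof (rule fps_ext)
    fix k show "fps_nth (\<Gamma> i * (1 + fps_const (- y i) * fps_X)) k = fps_nth 1 k"
      by (cases k) (auto simp: \<Gamma>_def ring_distribs mult.assoc[symmetric] simp del: fps_const_neg)
  qed
  have G_zero: "fps_nth (G i) l = 0" if "i < n" "n \<le> l" for i l
    unfolding G_def by (rule fps_nth_prod_linear_eq_0) (use that in auto)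
  have HG: "(\<Prod>i<n. \<Gamma> i) * G i = \<Gamma> i" if "i < n" for i
  proof -
    have "(\<Prod>i<n. \<Gamma> i) = \<Gamma> i * (\<Prod>l\<in>{..<n} - {i}. \<Gamma> l)"
      using that by (intro prod.remove) auto
    then have "(\<Prod>i<n. \<Gamma> i) * G i =
        \<Gamma> i * (\<Prod>l\<in>{..<n} - {i}. \<Gamma> l * (1 + fps_const (- y l) * fps_X))"
      by (simp only: G_def prod.distrib mult.assoc)
    then show ?thesis
      by (simp only: \<Gamma>_inv prod.neutral_const mult_1_right)
  qed
  have factor: "detf n (\<lambda>i j. y i ^ (p j + (n - 1 - j))) = detf n (\<lambda>i l. fps_nth (G i) (n - 1 - l)) *
      detf n (\<lambda>i j. h (int (p i) - int i + int j))" for p :: "nat \<Rightarrow> nat"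
  proof -
    have "detf n (\<lambda>i l. fps_nth (G i) (n - 1 - l)) * detf n (\<lambda>l j. h (int (p j) - int j + int l)) =
        detf n (\<lambda>i j. y i ^ (p j + (n - 1 - j)))"
      unfolding detf_mult
    proof (rule detf_cong)
      fix i j assume ij: "i < n" "j < n"
      define k where "k = p j + (n - 1 - j)"
      have "(\<Sum>l<n. fps_nth (G i) (n - 1 - l) * h (int (p j) - int j + int l)) =
          (\<Sum>l<n. fps_nth (G i) (n - Suc l) * h (int k - int (n - Suc l)))"
        using ij unfolding k_def by (intro sum.cong) (auto simp: of_nat_diff algebra_simps)
      also have "\<dots> = (\<Sum>l<n. fps_nth (G i) l * h (int k - int l))"
        by (rule sum.nat_diff_reindex)
      \<comment> \<open>\<open>G i\<close> has degree below n and h vanishes at negative indices, so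
        the n terms amount to the full convolution up to k.\<close>
      also have "\<dots> = (\<Sum>l<n + k + 1. fps_nth (G i) l * h (int k - int l))"
        using G_zero[OF \<open>i < n\<close>] by (intro sum.mono_neutral_left) auto
      also have "\<dots> = (\<Sum>l\<le>k. fps_nth (G i) l * hsum n y (k - l))"
        by (intro sum.mono_neutral_cong_right) (auto simp: h_def nat_diff_distrib')
      also have "\<dots> = fps_nth (G i * (\<Prod>i<n. \<Gamma> i)) k"
        by (simp add: fps_mult_nth hsum_def \<Gamma>_def atLeast0AtMost)
      also have "\<dots> = y i ^ k"
        using HG[OF \<open>i < n\<close>] by (simp add: mult.commute \<Gamma>_def)
      finally show "(\<Sum>l<n. fps_nth (G i) (n - 1 - l) * h (int (p j) - int j + int l)) =
          y i ^ (p j + (n - 1 - j))"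
        by (simp only: k_def)
    qed
    then show ?thesis
      using detf_transpose[of n "\<lambda>i j. h (int (p i) - int i + int j)"] by metis
  qed
  \<comment> \<open>For p = 0 the Jacobi-Trudi matrix is unitriangular, which identifies the
    determinant of the common factor with the Vandermonde alternant.\<close>
  have "detf n (\<lambda>i j. h (int 0 - int i + int j)) = 1"
    by (subst detf_upper_triangular) (auto simp: h_def hsum_def fps_nth_0_prod)
  then have "detf n (\<lambda>i j. y i ^ (n - 1 - j)) = detf n (\<lambda>i l. fps_nth (G i) (n - 1 - l))"
    using factor[of "\<lambda>_. 0"] by simp
  then show ?thesis
    using factor[of p] by (simp add: h_def Let_def mult.commute)
qed

text \<open>
  The type \<open>symfun\<close> also serves as the polynomial ring $\mathbb{Z}[y_0, y_1, \dots]$; the map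
  \<open>shift_map n a\<close> sends $y^c$ to $\prod_{i<n} h_{a_i - c_i}$.
\<close>

abbreviation var :: "nat \<Rightarrow> symfun" where
  "var i \<equiv> Poly_Mapping.single {#i#} 1"

definition shift_map :: "nat \<Rightarrow> (nat \<Rightarrow> int) \<Rightarrow> symfun \<Rightarrow> symfun" where
  "shift_map n a = linear_ext (\<lambda>c. \<Prod>i<n. complete_sym (a i - int (count c i)))"

lemma shift_map_add: "shift_map n a (p + p') = shift_map n a p + shift_map n a p'"
  by (simp add: shift_map_def linear_ext_add)

lemma shift_map_sum: "shift_map n a (sum f A) = (\<Sum>x\<in>A. shift_map n a (f x))"
  by (simp add: shift_map_def linear_ext_sum)

lemma shift_map_of_int_mult: "shift_map n a (of_int c * p) = of_int c * shift_map n a p"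
proof -
  have "shift_map n a (of_nat k * p) = of_nat k * shift_map n a p" for k
    by (induction k) (auto simp: shift_map_add ring_distribs, simp add: shift_map_def)
  then show ?thesis
    by (cases c rule: int_cases2) (auto simp: shift_map_def linear_ext_uminus)
qed

lemma var_power: "var i ^ k = Poly_Mapping.single (replicate_mset k i) 1"
  by (induction k) (auto simp: mult_single simp flip: single_one)

lemma single_eq_of_int_mult: "(Poly_Mapping.single c d :: symfun) = of_int d * Poly_Mapping.single c 1"
  by (simp add: mult_single flip: single_of_int)

text \<open>Induction on the number j of variables in \<open>hsum\<close>. Multiplication by y_j^k
  adds k copies of j to c and so lowers the index of factor j alone; factors not yet reached form
  the product over {j..<n}.\<close>

lemma shift_map_partial_hsum:
  assumes "j \<le> n"
  shows "shift_map n a (hsum j var r * Poly_Mapping.single c 1) =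
    fps_nth (\<Prod>i<j. Abs_fps (\<lambda>k. complete_sym (a i - int (count c i) - int k))) r *
    (\<Prod>i\<in>{j..<n}. complete_sym (a i - int (count c i)))"
  using assms
proof (induction j arbitrary: c r)
  case 0
  show ?case
    by (auto simp: hsum_def shift_map_def atLeast0LessThan)
next
  case (Suc j)
  let ?Q = "\<lambda>c. \<Prod>i<j. Abs_fps (\<lambda>k. complete_sym (a i - int (count c i) - int k))"
  let ?R = "\<lambda>c. \<Prod>i\<in>{Suc j..<n}. complete_sym (a i - int (count c i))"
  have "hsum (Suc j) var r * Poly_Mapping.single c 1 =
      (\<Sum>i\<le>r. hsum j var i * Poly_Mapping.single (replicate_mset (r - i) j + c) 1)"
    by (simp add: hsum_def fps_mult_nth var_power sum_distrib_right mult.assoc mult_single atLeast0AtMost)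
  then have "shift_map n a (hsum (Suc j) var r * Poly_Mapping.single c 1) =
      (\<Sum>i\<le>r. shift_map n a (hsum j var i * Poly_Mapping.single (replicate_mset (r - i) j + c) 1))"
    by (simp add: shift_map_sum)
  also have "\<dots> = (\<Sum>i\<le>r. fps_nth (?Q c) i *
      (complete_sym (a j - int (count c j) - int (r - i)) * ?R c))"
  proof (intro sum.cong refl)
    fix i assume "i \<in> {..r}"
    let ?c = "replicate_mset (r - i) j + c"
    have "shift_map n a (hsum j var i * Poly_Mapping.single ?c 1) =
        fps_nth (?Q ?c) i * (\<Prod>l\<in>{j..<n}. complete_sym (a l - int (count ?c l)))"
      using Suc.prems by (intro Suc.IH) auto
    also have "?Q ?c = ?Q c"
      by (intro prod.cong) auto
    also have "(\<Prod>l\<in>{j..<n}. complete_sym (a l - int (count ?c l))) =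
        complete_sym (a j - int (count ?c j)) * ?R ?c"
      using Suc.prems by (subst prod.atLeast_Suc_lessThan) auto
    also have "?R ?c = ?R c"
      by (intro prod.cong) auto
    finally show "shift_map n a (hsum j var i * Poly_Mapping.single ?c 1) = fps_nth (?Q c) i *
        (complete_sym (a j - int (count c j) - int (r - i)) * ?R c)"
      by (simp add: algebra_simps)
  qed
  also have "\<dots> = fps_nth (\<Prod>i<Suc j. Abs_fps (\<lambda>k. complete_sym (a i - int (count c i) - int k))) r * ?R c"
    by (simp add: fps_mult_nth sum_distrib_right atLeast0AtMost mult.assoc)
  finally show ?case .
qed

text \<open>\<open>lower_gf\<close> turns a product of h's into a product of series, one per factor,
  and expanding it lowers the indices in all ways of total r, just as the monomials of h_r(y) do.
  Negative indices are consistent, as a vanishing h stays zero when lowered.\<close>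

lemma lower_shift_map: "lower r (shift_map n a p) = shift_map n a (hsum n var r * p)"
proof (induction p rule: poly_mapping_single_induct)
  case (single c d)
  have "lower r (shift_map n a (Poly_Mapping.single c 1)) =
      shift_map n a (hsum n var r * Poly_Mapping.single c 1)"
    using shift_map_partial_hsum[of n n a r c]
    by (simp add: shift_map_def lower_def lower_gf.hom_prod lower_gf_complete_sym)
  then have "lower r (shift_map n a (of_int d * Poly_Mapping.single c 1)) =
      shift_map n a (of_int d * (hsum n var r * Poly_Mapping.single c 1))"
    by (simp only: shift_map_of_int_mult lower_of_int_mult)
  then show ?case
    by (simp only: single_eq_of_int_mult[of c d] mult_ac)
qed (simp add: shift_map_add lower_add ring_distribs)

lemma perp_shift_map: "perp f (shift_map n a p) = shift_map n a (specialize (hsum n var) f * p)"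
proof (induction f arbitrary: p rule: symfun_ring_induct)
  case (gen k)
  show ?case
    by (simp add: perp_complete_sym lower_shift_map specialize_complete_sym)
next
  case (uminus f)
  then show ?case
    by (simp add: perp_uminus_left specialize.hom_uminus) (simp add: shift_map_def linear_ext_uminus)
next
  case (mult f g)
  then show ?case
    by (simp add: perp_mult specialize.hom_mult mult.assoc)
qed (simp_all add: perp_1 perp_add_left specialize.hom_add ring_distribs shift_map_add)

lemma shift_map_detf:
  "shift_map n a (detf n (\<lambda>i j. var i ^ k j)) = detf n (\<lambda>i j. complete_sym (a i - int (k j)))"
proof -
  have prod_var: "(\<Prod>i<n. var i ^ e i) = Poly_Mapping.single (\<Sum>i<n. replicate_mset (e i) i) 1" for n e
    by (induction n) (auto simp: var_power mult_single simp flip: single_one)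
  have "count (\<Sum>i<n. replicate_mset (e i) i) i = (if i < n then e i else 0)" for n i :: nat and e
    by (induct n) auto
  then show ?thesis
    by (simp add: detf_altdef shift_map_sum shift_map_of_int_mult prod_var)
      (simp add: shift_map_def)
qed

text \<open>In a row n with part 0, the entries left of the diagonal have negative index and the
  diagonal entry is h_0 = 1.\<close>

lemma schur_eq_detf:
  assumes "plength \<mu> \<le> n"
  shows "schur \<mu> = detf n (\<lambda>i j. complete_sym (int (part \<mu> (i + 1)) - int i + int j))"
  using assms
proof (induction n rule: dec_induct)
  case base
  show ?case
    by (simp add: schur_def detf_def Let_def)
next
  case (step n)
  then show ?case
    by (subst detf_Suc) (auto simp: part_0)
qed

text \<open>\<open>shift_map\<close> sends the Vandermonde alternant to s_\<mu>. Multiplying the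
  alternant by s_\<rho>(y), which is the effect of \<open>perp\<close>, turns it into the alternant
  of \<rho>, whose image is the shifted determinant.\<close>

lemma perp_schur:
  assumes "plength \<mu> \<le> n" "plength \<rho> \<le> n"
  shows "perp (schur \<rho>) (schur \<mu>) = detf n (\<lambda>i j.
    complete_sym (int (part \<mu> (i + 1)) - int (part \<rho> (j + 1)) - int i + int j))"
proof -
  \<comment> \<open>The staircase is added so that subtracting the exponent n-1-j of the Vandermonde
    alternant leaves the Jacobi-Trudi index \<mu>_(i+1) - i + j.\<close>
  let ?a = "\<lambda>i. int (part \<mu> (i + 1)) + int (n - 1 - i)"
  let ?V = "detf n (\<lambda>i j. var i ^ (n - 1 - j))"
  have "specialize (hsum n var) (schur \<rho>) * ?V =
      detf n (\<lambda>i j. var i ^ (part \<rho> (j + 1) + (n - 1 - j)))"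
    unfolding jacobi_trudi schur_eq_detf[OF assms(2)] specialize.hom_detf
    by (intro arg_cong2[of _ _ _ _ "(*)"] detf_cong refl)
      (simp add: specialize_complete_sym Let_def hsum_def fps_nth_0_prod)
  moreover have "schur \<mu> = shift_map n ?a ?V"
    unfolding shift_map_detf schur_eq_detf[OF assms(1)]
    by (intro detf_cong arg_cong[of _ _ complete_sym]) auto
  ultimately have "perp (schur \<rho>) (schur \<mu>) =
      shift_map n ?a (detf n (\<lambda>i j. var i ^ (part \<rho> (j + 1) + (n - 1 - j))))"
    by (simp add: perp_shift_map)
  also have "\<dots> = detf n (\<lambda>i j.
      complete_sym (int (part \<mu> (i + 1)) - int (part \<rho> (j + 1)) - int i + int j))"
    unfolding shift_map_detf by (intro detf_cong arg_cong[of _ _ complete_sym]) auto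
  finally show ?thesis .
qed

section \<open>The Hall inner product\<close>

lemma strictly_decreasing_image_eq:
  fixes u v :: "nat \<Rightarrow> 'a::linorder"
  assumes u: "\<And>i j. i < j \<Longrightarrow> j < n \<Longrightarrow> u j < u i"
    and v: "\<And>i j. i < j \<Longrightarrow> j < n \<Longrightarrow> v j < v i"
    and im: "u ` {..<n} = v ` {..<n}" and "i < n"
  shows "u i = v i"
  using \<open>i < n\<close>
proof (induction i rule: less_induct)
  case (less i)
  have "u i \<in> v ` {..<n}" "v i \<in> u ` {..<n}"
    using less.prems im by auto
  then obtain j k where j: "j < n" "u i = v j" and k: "k < n" "v i = u k"
    by auto
  have "\<not> j < i"
    using less.IH[of j] u[of j i] less.prems j by auto
  then have "u i \<le> v i"
    using v[of i j] j by (cases "i = j") auto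
  have "\<not> k < i"
    using less.IH[of k] v[of k i] less.prems k by auto
  then have "v i \<le> u i"
    using u[of i k] k by (cases "i = k") auto
  then show ?case
    using \<open>u i \<le> v i\<close> by simp
qed

definition hall_form :: "symfun \<Rightarrow> symfun \<Rightarrow> int" where
  "hall_form f g = specialize (\<lambda>_. 0) (perp f g)"

text \<open>Constant terms turn the determinant of \<open>perp_schur\<close> into that of the
  coincidence matrix of two strictly decreasing sequences: the identity matrix if they agree, and a
  matrix with a zero row otherwise.\<close>

lemma hall_form_schur: "hall_form (schur \<rho>) (schur \<mu>) = (if \<rho> = \<mu> then 1 else 0)"
proof -
  define n where "n = max (plength \<mu>) (plength \<rho>)"
  have len: "plength \<mu> \<le> n" "plength \<rho> \<le> n"
    by (auto simp: n_def)
  define a where "a \<nu> i = int (part \<nu> (i + 1)) - int i" for \<nu> i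
  have a_less: "a \<nu> j < a \<nu> i" if "i < j" for \<nu> i j
    using that part_antimono[of "i + 1" "j + 1" \<nu>] by (simp add: a_def)
  have "hall_form (schur \<rho>) (schur \<mu>) = detf n (\<lambda>i j. if a \<mu> i = a \<rho> j then 1 else 0)"
    unfolding hall_form_def perp_schur[OF len] specialize.hom_detf
    by (intro detf_cong) (auto simp: specialize_complete_sym a_def)
  also have "\<dots> = (if \<rho> = \<mu> then 1 else 0)"
  proof (cases "\<rho> = \<mu>")
    case True
    then show ?thesis
      using a_less[of _ _ \<mu>] by (subst detf_upper_triangular) (auto dest: less_imp_neq)
  next
    case False
    \<comment> \<open>If every value occurred in both, the two sets of n values would coincide, and
      a set has only one strictly decreasing enumeration.\<close>
    have "\<exists>i<n. \<forall>j<n. a \<mu> i \<noteq> a \<rho> j"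
    proof (rule ccontr)
      assume "\<not> (\<exists>i<n. \<forall>j<n. a \<mu> i \<noteq> a \<rho> j)"
      then have "a \<mu> ` {..<n} \<subseteq> a \<rho> ` {..<n}"
        by auto
      moreover have "inj_on (a \<nu>) {..<n}" for \<nu>
        using a_less[of _ _ \<nu>] by (intro inj_onI) (metis less_irrefl linorder_neqE_nat)
      ultimately have "a \<mu> ` {..<n} = a \<rho> ` {..<n}"
        by (intro card_subset_eq) (auto simp: card_image)
      then have "a \<mu> i = a \<rho> i" if "i < n" for i
        using that a_less by (intro strictly_decreasing_image_eq[of n "a \<mu>" "a \<rho>"]) auto
      then have "part \<mu> i = part \<rho> i" if "1 \<le> i" for i
        using that part_0[of \<mu> i] part_0[of \<rho> i] len
        by (cases "i \<le> n") (auto simp: a_def dest: spec[of _ "i - 1"] elim!: meta_allE[of _ "i - 1"])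
      then show False
        using partition_eqI[of \<mu> \<rho>] False by auto
    qed
    then obtain i where "i < n" "\<forall>j<n. a \<mu> i \<noteq> a \<rho> j"
      by blast
    then have "detf n (\<lambda>i j. if a \<mu> i = a \<rho> j then 1 else 0) = (0 :: int)"
      by (intro detf_zero_row[of i]) auto
    then show ?thesis
      using False by simp
  qed
  finally show ?thesis .
qed

section \<open>Schur functions span the ring\<close>

lemma sum_mset_power2_le: "(\<Sum>x\<in>#m. (f x)\<^sup>2) \<le> (\<Sum>x\<in>#m. f x :: nat)\<^sup>2"
  by (induction m) (auto simp: power2_sum)

text \<open>Summation by parts as an induction: while partial sums are nonnegative, passing from the
  weight \<open>l n\<close> to the smaller \<open>l (Suc n)\<close> can only decrease the left
  side.\<close>

lemma abel_sum_le:
  fixes l d :: "nat \<Rightarrow> int"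
  assumes "\<And>i. 0 \<le> l i" "\<And>i. l (Suc i) \<le> l i" "\<And>k. k \<le> n \<Longrightarrow> 0 \<le> (\<Sum>i<k. d i)"
  shows "l n * (\<Sum>i<n. d i) \<le> (\<Sum>i<n. l i * d i)"
  using assms(3)
proof (induction n)
  case (Suc n)
  have "l (Suc n) * (\<Sum>i<Suc n. d i) \<le> l n * (\<Sum>i<Suc n. d i)"
    using Suc.prems[of "Suc n"] assms(2) by (intro mult_right_mono) auto
  also have "\<dots> = l n * (\<Sum>i<n. d i) + l n * d n"
    by (simp add: ring_distribs)
  also have "\<dots> \<le> (\<Sum>i<Suc n. l i * d i)"
    using Suc by simp
  finally show ?case .
qed auto

text \<open>With d_i = p(i) - i, the two sides differ by 2 \<Sum> l_i d_i + \<Sum> d_i^2. The first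
  sum is nonnegative by Abel summation, because k distinct naturals sum to at least 0 + ... + (k-1);
  the second is positive for p \<noteq> id. The sum of squares stands in for the dominance order in
  the triangularity between h's and Schur functions.\<close>

lemma permutes_sum_squares:
  fixes p :: "nat \<Rightarrow> nat"
  assumes p: "p permutes {..<n}" "p \<noteq> id"
  shows "(\<Sum>i<n. (int (part \<mu> (Suc i)))\<^sup>2) < (\<Sum>i<n. (int (part \<mu> (Suc i)) - int i + int (p i))\<^sup>2)"
proof -
  let ?l = "\<lambda>i. int (part \<mu> (Suc i))" and ?d = "\<lambda>i. int (p i) - int i"
  have partial: "0 \<le> (\<Sum>i<k. ?d i)" for k
  proof -
    have "inj_on p {..<k}"
      using permutes_inj_on[OF p(1)] by blast
    then have "(\<Sum>i<k. i) \<le> (\<Sum>i<k. p i)"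
      using card_sum_le_nat_sum[of "p ` {..<k}"]
      by (simp add: card_image sum.reindex atLeast0LessThan)
    then have "(\<Sum>i<k. int i) \<le> (\<Sum>i<k. int (p i))"
      by (simp flip: of_nat_sum)
    then show ?thesis
      by (simp add: sum_subtractf)
  qed
  have "0 \<le> ?l n * (\<Sum>i<n. ?d i)"
    using partial by simp
  also have "\<dots> \<le> (\<Sum>i<n. ?l i * ?d i)"
    using partial part_antimono[of "Suc _" "Suc (Suc _)" \<mu>] by (intro abel_sum_le) auto
  finally have cross: "0 \<le> (\<Sum>i<n. ?l i * ?d i)" .
  obtain i where "p i \<noteq> i"
    using p(2) by (auto simp: fun_eq_iff)
  then have "i < n"
    using p(1) by (auto simp: permutes_def)
  then have "0 < (\<Sum>i<n. (?d i)\<^sup>2)"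
    using \<open>p i \<noteq> i\<close> by (intro sum_pos2[of _ i]) auto
  moreover have "(\<Sum>i<n. (?l i - int i + int (p i))\<^sup>2) =
      (\<Sum>i<n. (?l i)\<^sup>2 + 2 * (?l i * ?d i) + (?d i)\<^sup>2)"
    by (intro sum.cong) (auto simp: power2_eq_square algebra_simps)
  then have "(\<Sum>i<n. (?l i - int i + int (p i))\<^sup>2) =
      (\<Sum>i<n. (?l i)\<^sup>2) + 2 * (\<Sum>i<n. ?l i * ?d i) + (\<Sum>i<n. (?d i)\<^sup>2)"
    by (simp add: sum.distrib sum_distrib_left)
  ultimately show ?thesis
    using cross by linarith
qed

text \<open>The multiset keeps only the nonzero c_i, since h_0 = 1; zeros affect neither the weight
  nor the sum of squares. \<open>Suc\<close> appears because the index x stands for h_(x+1).\<close>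

lemma prod_complete_sym_eq_single:
  fixes c :: "nat \<Rightarrow> nat"
  shows "\<exists>m. (\<Prod>i<n. complete_sym (int (c i))) = Poly_Mapping.single m 1 \<and>
    (\<Sum>x\<in>#m. Suc x) = (\<Sum>i<n. c i) \<and> (\<Sum>x\<in>#m. (Suc x)\<^sup>2) = (\<Sum>i<n. (c i)\<^sup>2)"
proof (induction n)
  case 0
  show ?case
    by (intro exI[of _ "{#}"]) simp
next
  case (Suc n)
  then obtain m where m: "(\<Prod>i<n. complete_sym (int (c i))) = Poly_Mapping.single m 1"
    "(\<Sum>x\<in>#m. Suc x) = (\<Sum>i<n. c i)" "(\<Sum>x\<in>#m. (Suc x)\<^sup>2) = (\<Sum>i<n. (c i)\<^sup>2)"
    by auto
  show ?case
  proof (cases "c n")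
    case 0
    then show ?thesis
      using m by (intro exI[of _ m]) simp
  next
    case (Suc k)
    then show ?thesis
      using m by (intro exI[of _ "add_mset k m"]) (simp add: single_add_mset mult.commute)
  qed
qed

text \<open>In the Leibniz expansion of the Jacobi-Trudi determinant the identity contributes
  h_\<mu>, and every other permutation contributes, up to sign, zero or a monomial of the same
  weight with a larger sum of squares. Solving for h_\<mu> expresses it by s_\<mu> and monomials
  covered by induction.\<close>

lemma schur_span_induct [case_names schur add uminus]:
  assumes schur: "\<And>\<mu>. P (schur \<mu>)"
    and add: "\<And>f g. P f \<Longrightarrow> P g \<Longrightarrow> P (f + g)"
    and uminus: "\<And>f. P f \<Longrightarrow> P (- f)"
  shows "P f"
proof (induction f rule: poly_mapping_single_induct)
  case (single m c)
  have zero: "P 0"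
    using add[OF schur uminus[OF schur]] by (metis add.right_inverse)
  have sum: "P (sum g A)" if "\<And>x. x \<in> A \<Longrightarrow> P (g x)" for g :: "(nat \<Rightarrow> nat) \<Rightarrow> symfun" and A
    using that by (induction A rule: infinite_finite_induct) (auto intro: zero add)
  have "P (Poly_Mapping.single m 1)"
  \<comment> \<open>The sum of squares is at most the square of the weight; at fixed weight, a
    larger sum of squares therefore gives a smaller natural number here.\<close>
  proof (induction "(\<Sum>x\<in>#m. Suc x)\<^sup>2 - (\<Sum>x\<in>#m. (Suc x)\<^sup>2)" arbitrary: m rule: less_induct)
    case (less m)
    define xs where "xs = rev (sorted_list_of_multiset (image_mset Suc m))"
    have mset_xs: "mset xs = image_mset Suc m"
      by (simp add: xs_def)
    have "0 \<notin># mset xs"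
      by (simp add: mset_xs)
    moreover have "sorted_wrt (\<ge>) xs"
      by (simp add: xs_def sorted_wrt_rev)
    ultimately have parts: "parts (Partition xs) = xs"
      by (intro Partition_inverse) auto
    define \<mu> n where "\<mu> = Partition xs" and "n = length xs"
    have n: "plength \<mu> = n" and part: "i < n \<Longrightarrow> part \<mu> (Suc i) = xs ! i" for i
      by (auto simp: \<mu>_def n_def plength_def part_def parts)
    have sum_xs: "(\<Sum>i<n. F (part \<mu> (Suc i))) = (\<Sum>x\<in>#m. F (Suc x))" for F :: "nat \<Rightarrow> nat"
    proof -
      have "(\<Sum>i<n. F (part \<mu> (Suc i))) = sum_list (map F xs)"
        by (simp add: sum_list_sum_nth part n_def atLeast0LessThan)
      also have "\<dots> = sum_mset (image_mset F (mset xs))"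
        by (simp flip: sum_mset_sum_list)
      finally show ?thesis
        by (simp add: mset_xs image_mset.compositionality comp_def)
    qed
    have prod_xs: "(\<Prod>i<n. complete_sym (int (part \<mu> (Suc i)))) = Poly_Mapping.single m 1"
    proof -
      have "(\<Prod>i<n. complete_sym (int (part \<mu> (Suc i)))) = prod_list (map (\<lambda>x. complete_sym (int x)) xs)"
        by (simp add: prod.list_conv_set_nth part n_def atLeast0LessThan)
      also have "\<dots> = prod_mset (image_mset (\<lambda>x. complete_sym (int x)) (mset xs))"
        by (simp flip: prod_mset_prod_list)
      also have "\<dots> = (\<Prod>k\<in>#m. complete_sym (int (Suc k)))"
        by (simp add: mset_xs image_mset.compositionality comp_def)
      also have "\<dots> = Poly_Mapping.single m 1"
        by (induction m) (simp_all add: single_add_mset flip: single_one)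
      finally show ?thesis .
    qed
    define t where "t p = (of_int (sign p) *
      (\<Prod>i<n. complete_sym (int (part \<mu> (Suc i)) - int i + int (p i))) :: symfun)" for p
    have t: "P (t p)" if p: "p permutes {..<n}" "p \<noteq> id" for p
    proof -
      let ?e = "\<lambda>i. int (part \<mu> (Suc i)) - int i + int (p i)"
      have "P (\<Prod>i<n. complete_sym (?e i))"
      proof (cases "\<exists>i<n. ?e i < 0")
        case True
        then have "(\<Prod>i<n. complete_sym (?e i)) = 0"
          by (intro prod_zero) (auto intro: complete_sym_simps)
        then show ?thesis
          using zero by simp
      next
        case False
        define e where "e i = nat (?e i)" for i
        have e: "int (e i) = ?e i" if "i < n" for i
        proof -
          have "\<not> ?e i < 0"
            using False that by blast
          then show ?thesis
            by (simp add: e_def)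
        qed
        obtain m' where m': "(\<Prod>i<n. complete_sym (int (e i))) = Poly_Mapping.single m' 1"
          "(\<Sum>x\<in>#m'. Suc x) = (\<Sum>i<n. e i)" "(\<Sum>x\<in>#m'. (Suc x)\<^sup>2) = (\<Sum>i<n. (e i)\<^sup>2)"
          using prod_complete_sym_eq_single[of e n] by auto
        have "int (\<Sum>i<n. e i) = (\<Sum>i<n. ?e i)"
          by (simp add: e)
        also have "\<dots> = (\<Sum>i<n. int (part \<mu> (Suc i))) - (\<Sum>i<n. int i) + (\<Sum>i<n. int (p i))"
          by (simp add: sum.distrib sum_subtractf)
        also have "(\<Sum>i<n. int (p i)) = (\<Sum>i<n. int i)"
          using sum.permute[OF p(1), of int] by (simp add: comp_def)
        finally have "int (\<Sum>i<n. e i) = int (\<Sum>i<n. part \<mu> (Suc i))"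
          by simp
        then have w: "(\<Sum>x\<in>#m'. Suc x) = (\<Sum>x\<in>#m. Suc x)"
          using m'(2) sum_xs[of "\<lambda>x. x"] by linarith
        have "int (\<Sum>i<n. (part \<mu> (Suc i))\<^sup>2) < int (\<Sum>i<n. (e i)\<^sup>2)"
          using permutes_sum_squares[OF p, of \<mu>]
          by (simp add: e)
        then have "(\<Sum>x\<in>#m. (Suc x)\<^sup>2) < (\<Sum>x\<in>#m'. (Suc x)\<^sup>2)"
          using m'(3) sum_xs[of "\<lambda>x. x\<^sup>2"] by linarith
        then have "P (Poly_Mapping.single m' 1)"
          using sum_mset_power2_le[of Suc m'] by (intro less.hyps) (simp only: w)
        then show ?thesis
          using m'(1) e by simp
      qed
      then show ?thesis
        by (auto simp: t_def sign_def intro: uminus)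
    qed
    have "schur \<mu> = (\<Sum>p | p permutes {..<n}. t p)"
      by (simp add: schur_eq_detf[of \<mu> n] n detf_altdef t_def)
    also have "\<dots> = t id + (\<Sum>p\<in>{p. p permutes {..<n}} - {id}. t p)"
      by (intro sum.remove) (auto simp: permutes_id finite_permutations)
    also have "t id = Poly_Mapping.single m 1"
      by (simp add: t_def prod_xs sign_id)
    finally have "Poly_Mapping.single m 1 = schur \<mu> + - (\<Sum>p\<in>{p. p permutes {..<n}} - {id}. t p)"
      by (simp add: id_def)
    moreover have "P \<dots>"
      using t by (intro add schur uminus sum) auto
    ultimately show ?case
      by simp
  qed
  then have "P (of_nat k * Poly_Mapping.single m 1)" for k
    by (induction k) (auto simp: ring_distribs intro: add zero)
  then have "P (of_int c * Poly_Mapping.single m 1)"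
    by (cases c rule: int_cases2) (auto intro: uminus)
  then show ?case
    by (simp add: single_eq_of_int_mult[of m c])
qed (rule add)

section \<open>Uniqueness of the Hall product and adjointness\<close>

lemma is_hall_product_hall_form: "is_hall_product hall_form"
  unfolding is_hall_product_def hall_form_schur
  by (auto simp: hall_form_def perp_add_left perp_add_right specialize.hom_add)

lemma is_hall_product_unique:
  assumes "is_hall_product A" "is_hall_product B"
  shows "A = B"
proof -
  have uminus: "C (- f) g = - C f g" "C f (- g) = - C f g" if "is_hall_product C" for C f g
  proof -
    have add: "C (f + f') g = C f g + C f' g" "C f (g + g') = C f g + C f g'" for f f' g g'
      using that unfolding is_hall_product_def by blast+
    show "C (- f) g = - C f g" "C f (- g) = - C f g"
      using add(1)[of 0 0 g] add(1)[of f "- f" g] add(2)[of f 0 0] add(2)[of f g "- g"] by auto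
  qed
  note uminus = uminus[OF assms(1)] uminus[OF assms(2)]
  have "A f g = B f g" for f g
  proof (induction f arbitrary: g rule: schur_span_induct)
    case (schur \<mu>)
    show ?case
      by (induction g rule: schur_span_induct)
        (use assms uminus in \<open>auto simp: is_hall_product_def\<close>)
  qed (use assms uminus in \<open>auto simp: is_hall_product_def\<close>)
  then show ?thesis
    by blast
qed

lemma hall_product_eq: "hall_product = hall_form"
  unfolding hall_product_def
  using is_hall_product_hall_form is_hall_product_unique by (intro the_equality) auto

lemma hall_form_add: "hall_form (f + g) h = hall_form f h + hall_form g h"
  "hall_form h (f + g) = hall_form h f + hall_form h g"
  using is_hall_product_hall_form by (auto simp: is_hall_product_def)

lemma hall_form_uminus: "hall_form (- f) h = - hall_form f h" "hall_form h (- f) = - hall_form h f"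
  using hall_form_add(1)[of f "- f" h] hall_form_add(1)[of 0 0 h]
    hall_form_add(2)[of h f "- f"] hall_form_add(2)[of h 0 0] by auto

text \<open>The two arguments play different roles in \<open>hall_form\<close>; symmetry comes from
  orthonormality on a spanning set.\<close>

lemma hall_form_commute: "hall_form f g = hall_form g f"
proof (induction f arbitrary: g rule: schur_span_induct)
  case (schur \<mu>)
  show ?case
    by (induction g rule: schur_span_induct) (auto simp: hall_form_schur hall_form_add hall_form_uminus)
qed (auto simp: hall_form_add hall_form_uminus)

text \<open>Admitting every finite superset T of the support lets two summands be expanded over a
  common index set.\<close>

lemma schur_expansion:
  "\<exists>S. finite S \<and> (\<forall>T. finite T \<longrightarrow> S \<subseteq> T \<longrightarrow> f = (\<Sum>\<sigma>\<in>T. of_int (hall_form f (schur \<sigma>)) * schur \<sigma>))"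
proof (induction f rule: schur_span_induct)
  case (schur \<mu>)
  have "schur \<mu> = (\<Sum>\<sigma>\<in>T. of_int (hall_form (schur \<mu>) (schur \<sigma>)) * schur \<sigma>)"
    if "finite T" "\<mu> \<in> T" for T
  proof -
    have "(\<Sum>\<sigma>\<in>T. of_int (hall_form (schur \<mu>) (schur \<sigma>)) * schur \<sigma>) =
        (\<Sum>\<sigma>\<in>T. if \<sigma> = \<mu> then schur \<sigma> else 0)"
      by (intro sum.cong) (auto simp: hall_form_schur)
    then show ?thesis
      using that by simp
  qed
  then show ?case
    by (intro exI[of _ "{\<mu>}"]) auto
next
  case (add f g)
  then obtain S S' where "finite S" "finite S'"
    "\<And>T. finite T \<Longrightarrow> S \<subseteq> T \<Longrightarrow> f = (\<Sum>\<sigma>\<in>T. of_int (hall_form f (schur \<sigma>)) * schur \<sigma>)"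
    "\<And>T. finite T \<Longrightarrow> S' \<subseteq> T \<Longrightarrow> g = (\<Sum>\<sigma>\<in>T. of_int (hall_form g (schur \<sigma>)) * schur \<sigma>)"
    by blast
  then show ?case
    by (intro exI[of _ "S \<union> S'"]) (auto simp: hall_form_add ring_distribs sum.distrib)
next
  case (uminus f)
  then show ?case
    by (auto simp: hall_form_uminus sum_negf)
qed

text \<open>Adjointness is \<open>perp_mult\<close> read through the symmetry of the form.
  Uniqueness holds because an element orthogonal to all Schur functions has zero Schur
  expansion.\<close>

lemma skew_schur_eq_perp: "skew_schur \<mu> \<rho> = perp (schur \<rho>) (schur \<mu>)"
  unfolding skew_schur_def hall_product_eq
proof (rule the_equality)
  show "\<forall>\<sigma>. hall_form (perp (schur \<rho>) (schur \<mu>)) (schur \<sigma>) =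
      hall_form (schur \<mu>) (schur \<rho> * schur \<sigma>)"
    by (subst (1 2) hall_form_commute) (simp add: hall_form_def mult.commute flip: perp_mult)
next
  fix f assume f: "\<forall>\<sigma>. hall_form f (schur \<sigma>) = hall_form (schur \<mu>) (schur \<rho> * schur \<sigma>)"
  define d where "d = f + - perp (schur \<rho>) (schur \<mu>)"
  have "hall_form (perp (schur \<rho>) (schur \<mu>)) (schur \<sigma>) =
      hall_form (schur \<mu>) (schur \<rho> * schur \<sigma>)" for \<sigma>
    by (subst (1 2) hall_form_commute) (simp add: hall_form_def mult.commute flip: perp_mult)
  then have "hall_form d (schur \<sigma>) = 0" for \<sigma>
    using f unfolding d_def hall_form_add hall_form_uminus by simp
  then have "d = 0"
    using schur_expansion[of d] by auto
  then show "f = perp (schur \<rho>) (schur \<mu>)"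
    by (simp add: d_def)
qed

lemma skew_schur_eq_detf:
  assumes "plength \<mu> \<le> n" "plength \<rho> \<le> n"
  shows "skew_schur \<mu> \<rho> = detf n (\<lambda>i j.
    complete_sym (int (part \<mu> (i + 1)) - int (part \<rho> (j + 1)) - int i + int j))"
  unfolding skew_schur_eq_perp by (rule perp_schur[OF assms])

section \<open>The dual Jacobi-Trudi identity\<close>

context
  fixes N m :: nat and p c :: "nat \<Rightarrow> nat"
  assumes p_anti: "\<And>i i'. i \<le> i' \<Longrightarrow> p i' \<le> p i"
    and p_le: "\<And>i. p i \<le> m"
    and c_eq: "\<And>j. c j = card {i \<in> {..<N}. j < p i}"
begin

text \<open>The Maya diagram of p in an N by m box: the first N indices list the bead positions in
  decreasing order, the next m the holes in increasing order. Beyond them it is the identity, as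
  \<open>permutes\<close> demands.\<close>

definition bead_perm :: "nat \<Rightarrow> nat" where
  "bead_perm k = (if k < N then p k + (N - 1 - k) else
     if k < N + m then N + (k - N) - c (k - N) else k)"

lemma less_part_iff:
  assumes "i < N"
  shows "j < p i \<longleftrightarrow> i < c j"
proof -
  have "{i \<in> {..<N}. j < p i} = {..<c j}"
    unfolding c_eq by (rule initial_segment_card[OF p_anti])
  then have "i \<in> {i \<in> {..<N}. j < p i} \<longleftrightarrow> i \<in> {..<c j}"
    by (simp only:)
  then show ?thesis
    using assms by simp
qed

lemma c_le: "c j \<le> N"
  unfolding c_eq using card_mono[of "{..<N}" "{i \<in> {..<N}. j < p i}"] by auto

lemma c_anti: "j \<le> j' \<Longrightarrow> c j' \<le> c j"
  unfolding c_eq by (intro card_mono) auto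

lemma bead_perm_bead: "i < N \<Longrightarrow> bead_perm i = p i + (N - 1 - i)"
  by (simp add: bead_perm_def)

lemma bead_perm_hole: "j < m \<Longrightarrow> bead_perm (N + j) = N + j - c j"
  by (simp add: bead_perm_def)

lemma bead_perm_less_bead:
  assumes "i < j" "j < N"
  shows "bead_perm j < bead_perm i"
proof -
  have "bead_perm i = p i + (N - 1 - i)" "bead_perm j = p j + (N - 1 - j)"
    using assms by (simp_all only: bead_perm_bead)
  then show ?thesis
    using assms p_anti[of i j] by linarith
qed

lemma bead_perm_less_hole:
  assumes "i < j" "j < m"
  shows "bead_perm (N + i) < bead_perm (N + j)"
proof -
  have "bead_perm (N + i) = N + i - c i" "bead_perm (N + j) = N + j - c j"
    using assms by (simp_all only: bead_perm_hole)
  then show ?thesis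
    using assms c_anti[of i j] c_le[of i] by linarith
qed

text \<open>A hole precedes a bead exactly when the corresponding box lies in the diagram: j < p_i
  is equivalent to i < c_j, and both inequalities push the positions N + j - c_j and p_i + N-1-i
  apart in the same direction.\<close>

lemma bead_perm_hole_less_bead_iff:
  assumes "i < N" "j < m"
  shows "bead_perm (N + j) < bead_perm i \<longleftrightarrow> j < p i"
    and "bead_perm i < bead_perm (N + j) \<longleftrightarrow> \<not> j < p i"
proof -
  have eq: "bead_perm i = p i + (N - 1 - i)" "bead_perm (N + j) = N + j - c j"
    using assms by (simp_all only: bead_perm_bead bead_perm_hole)
  have "bead_perm (N + j) < bead_perm i" if "j < p i"
  proof -
    have "i < c j"
      using less_part_iff[OF assms(1)] that by simp
    then show ?thesis
      unfolding eq using assms that c_le[of j] by linarith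
  qed
  moreover have "bead_perm i < bead_perm (N + j)" if "\<not> j < p i"
  proof -
    have "\<not> i < c j"
      using less_part_iff[OF assms(1)] that by simp
    then show ?thesis
      unfolding eq using assms that by linarith
  qed
  ultimately show "bead_perm (N + j) < bead_perm i \<longleftrightarrow> j < p i"
    "bead_perm i < bead_perm (N + j) \<longleftrightarrow> \<not> j < p i"
    by (meson less_asym)+
qed

lemma bead_perm_neq:
  assumes "i < j" "j < N + m"
  shows "bead_perm i \<noteq> bead_perm j"
proof (cases "j < N")
  case True
  then show ?thesis
    using bead_perm_less_bead[OF assms(1)] by simp
next
  case False
  then obtain t where t: "j = N + t" "t < m"
    using assms(2) le_Suc_ex[of N j] by auto
  show ?thesis
  proof (cases "i < N")
    case True
    then show ?thesis
      using bead_perm_hole_less_bead_iff[OF True t(2)] unfolding t(1) by fastforce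
  next
    case False
    then obtain s where s: "i = N + s"
      using le_Suc_ex[of N i] by auto
    then have "s < t"
      using assms(1) t(1) by simp
    then show ?thesis
      using bead_perm_less_hole[OF _ t(2)] unfolding s t(1) by fastforce
  qed
qed

lemma bead_perm_permutes: "bead_perm permutes {..<N + m}"
proof -
  have inj: "inj_on bead_perm {..<N + m}"
  proof (rule inj_onI)
    fix i j assume ij: "i \<in> {..<N + m}" "j \<in> {..<N + m}" "bead_perm i = bead_perm j"
    then have "\<not> i < j" "\<not> j < i"
      using bead_perm_neq[of i j] bead_perm_neq[of j i] by force+
    then show "i = j"
      by simp
  qed
  have "bead_perm k < N + m" if "k < N + m" for k
  proof (cases "k < N")
    case True
    then show ?thesis
      using p_le[of k] by (simp add: bead_perm_bead)
  next
    case False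
    then show ?thesis
      using that by (simp add: bead_perm_def)
  qed
  then have "bead_perm ` {..<N + m} \<subseteq> {..<N + m}"
    by blast
  then have "bead_perm ` {..<N + m} = {..<N + m}"
    by (rule endo_inj_surj[OF finite_lessThan _ inj])
  moreover have "bead_perm k = k" if "k \<notin> {..<N + m}" for k
    using that by (simp add: bead_perm_def)
  ultimately show ?thesis
    using inj bij_betw_def bij_imp_permutes by metis
qed

text \<open>Inversions are counted: every pair of beads, no pair of holes, and for hole j the c_j
  beads above it.\<close>

lemma sign_bead_perm:
  "sign bead_perm = (\<Prod>i<N. \<Prod>j<i. - 1) * (\<Prod>j<m. (- 1) ^ c j)"
proof -
  have "(\<Prod>j<N. sgn (int (bead_perm (N + s)) - int (bead_perm j))) = (- 1) ^ c s" if "s < m" for s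
  proof -
    have "(\<Prod>j<N. sgn (int (bead_perm (N + s)) - int (bead_perm j))) =
        (\<Prod>j<N. if j < c s then - 1 else 1)"
    proof (rule prod.cong)
      fix j assume "j \<in> {..<N}"
      then show "sgn (int (bead_perm (N + s)) - int (bead_perm j)) = (if j < c s then - 1 else 1)"
        using bead_perm_hole_less_bead_iff[of j s] less_part_iff[of j s] that
        by (auto simp: sgn_if)
    qed auto
    also have "\<dots> = (\<Prod>j\<in>{..<c s}. - 1)"
      using c_le[of s] by (intro prod.mono_neutral_cong_right) auto
    finally show ?thesis
      by simp
  qed
  moreover have "(\<Prod>j<s. sgn (int (bead_perm (N + s)) - int (bead_perm (N + j)))) = 1" if "s < m" for s
    using bead_perm_less_hole[OF _ that] by (intro prod.neutral) auto
  ultimately have holes: "(\<Prod>s<m. \<Prod>j<N + s. sgn (int (bead_perm (N + s)) - int (bead_perm j))) =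
      (\<Prod>j<m. (- 1) ^ c j)"
    unfolding prod_lessThan_add by (intro prod.cong) auto
  have "sgn (int (bead_perm i) - int (bead_perm j)) = - 1" if "j < i" "i < N" for i j
    using bead_perm_less_bead[OF that] by simp
  then have "(\<Prod>i<N. \<Prod>j<i. sgn (int (bead_perm i) - int (bead_perm j))) =
      (\<Prod>i<N. \<Prod>j<i. - 1)"
    by (intro prod.cong) auto
  with holes show ?thesis
    by (simp only: sign_eq_prod_sgn[OF bead_perm_permutes] prod_lessThan_add[of _ N m])
qed

text \<open>The rows of \<open>T\<close> are unit vectors at the bead positions followed by
  coefficient vectors of multiples of F = \<Prod>(X - x_i); the columns of \<open>G\<close> are
  power vectors of the x_i followed by unit vectors. Since F(x_i) = 0, their product is block
  triangular, with the alternant of p and a unitriangular block on the diagonal. The determinant of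
  \<open>T\<close> itself reduces to the signed minor of coefficients of F in the hole
  columns.\<close>

lemma dual_jacobi_trudi_aux:
  fixes x :: "nat \<Rightarrow> 'a::idom"
  defines "E \<equiv> (\<Prod>i<N. 1 + fps_const (x i) * fps_X)"
  defines "e \<equiv> (\<lambda>r::int. if r < 0 then 0 else fps_nth E (nat r))"
  shows "detf N (\<lambda>i j. x i ^ (p j + (N - 1 - j))) =
    (\<Prod>i<N. \<Prod>j<i. - 1) * detf m (\<lambda>i j. e (int (c i) - int i + int j)) * detf N (\<lambda>i j. x i ^ j)"
proof -
  define F where "F = (\<Prod>i<N. [:- x i, 1:])"
  \<comment> \<open>Coefficients of F are signed elementary symmetric polynomials; this is the link
    between F and the series E.\<close>
  have coeff_F: "coeff (\<Prod>i<n. [:- x i, 1:]) k =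
      (if k \<le> n then (- 1) ^ (n - k) * fps_nth (\<Prod>i<n. 1 + fps_const (x i) * fps_X) (n - k) else 0)"
    for n k
  proof (induction n arbitrary: k)
    case 0
    show ?case
      by (auto simp: coeff_1)
  next
    case (Suc n)
    let ?P = "\<lambda>n. \<Prod>i<n. [:- x i, 1:]" and ?E = "\<lambda>n. \<Prod>i<n. 1 + fps_const (x i) * fps_X"
    have P: "coeff (?P (Suc n)) k = (if k = 0 then 0 else coeff (?P n) (k - 1)) - x n * coeff (?P n) k"
      by (cases k) auto
    have E: "fps_nth (?E (Suc n)) r =
        fps_nth (?E n) r + (if r = 0 then 0 else x n * fps_nth (?E n) (r - 1))" for r
    proof -
      have "?E (Suc n) = ?E n + fps_const (x n) * (fps_X * ?E n)"
        by (simp add: algebra_simps)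
      then show ?thesis
        by (simp only:) (cases r; simp)
    qed
    consider "n < k" | "k = 0" | d where "n = k + d" "k > 0"
      by (metis gr0I le_Suc_ex not_le)
    then show ?case
    proof cases
      case 2
      have "fps_nth (?E n) (Suc n) = 0"
        by (intro fps_nth_prod_linear_eq_0) auto
      then show ?thesis
        unfolding P E Suc.IH using 2 by simp
    next
      case 3
      then have "n - (k - 1) = Suc d" "Suc n - k = Suc d" "k - 1 \<le> n"
        by auto
      then show ?thesis
        unfolding P E Suc.IH using 3 by (simp add: ring_distribs)
    qed (unfold P E Suc.IH, auto)
  qed
  \<comment> \<open>\<open>C s\<close> is the coefficient vector of X^s F, which vanishes at every
    x_i.\<close>
  define C where "C s k = (if s \<le> k then coeff F (k - s) else 0)" for s k
  have C_root: "(\<Sum>k<N + m. C s k * x i ^ k) = 0" if "s < m" "i < N" for s i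
  proof -
    have "degree F \<le> N"
      by (intro degree_le) (simp add: F_def coeff_F)
    have "(\<Sum>k<N + m. C s k * x i ^ k) = (\<Sum>k\<in>(\<lambda>k. k + s) ` {..degree F}. C s k * x i ^ k)"
    proof (intro sum.mono_neutral_right ballI)
      fix k assume k: "k \<in> {..<N + m} - (\<lambda>k. k + s) ` {..degree F}"
      have "degree F < k - s" if "s \<le> k"
      proof (rule ccontr)
        assume "\<not> degree F < k - s"
        then have "k \<in> (\<lambda>k. k + s) ` {..degree F}"
          using that by (intro image_eqI[of _ _ "k - s"]) auto
        then show False
          using k by blast
      qed
      then show "C s k * x i ^ k = 0"
        by (auto simp: C_def intro: coeff_eq_0)
    qed (use that \<open>degree F \<le> N\<close> in auto)
    also have "\<dots> = (\<Sum>k\<le>degree F. coeff F k * x i ^ (k + s))"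
      by (subst sum.reindex) (auto simp: C_def)
    also have "\<dots> = x i ^ s * poly F (x i)"
      by (simp add: poly_altdef power_add sum_distrib_left mult_ac)
    also have "poly F (x i) = 0"
      using \<open>i < N\<close> by (auto simp: F_def poly_prod)
    finally show ?thesis
      by simp
  qed
  define T where "T r k = (if r < N then if k = bead_perm r then 1 else 0 else C (r - N) k)" for r k
  define G where "G k i = (if i < N then x i ^ k else if k = i then 1 else 0)" for k i
  have bead_less: "bead_perm k < N + m" if "k < N + m" for k
    using permutes_in_image[OF bead_perm_permutes, of k] that by simp
  have TG: "(\<Sum>k<N + m. T r k * G k i) = (if r < N then G (bead_perm r) i
      else if i < N then 0 else C (r - N) i)" if "r < N + m" "i < N + m" for r i
  proof -
    have "(\<Sum>k<N + m. T r k * G k i) = G (bead_perm r) i" if "r < N"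
    proof -
      have "(\<Sum>k<N + m. T r k * G k i) = (\<Sum>k<N + m. if k = bead_perm r then G k i else 0)"
        using that by (intro sum.cong) (auto simp: T_def)
      then show ?thesis
        using bead_less[of r] that by simp
    qed
    moreover have "(\<Sum>k<N + m. T r k * G k i) = C (r - N) i" if "\<not> r < N" "\<not> i < N"
    proof -
      have "(\<Sum>k<N + m. T r k * G k i) = (\<Sum>k<N + m. if k = i then C (r - N) k else 0)"
        using that by (intro sum.cong) (auto simp: T_def G_def)
      then show ?thesis
        using \<open>i < N + m\<close> by simp
    qed
    moreover have "(\<Sum>k<N + m. T r k * G k i) = 0" if "\<not> r < N" "i < N"
      using C_root[of "r - N" i] that \<open>r < N + m\<close> by (simp add: T_def G_def)
    ultimately show ?thesis
      by auto
  qed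
  have "detf (N + m) T * detf (N + m) G = detf (N + m) (\<lambda>r i. if r < N then G (bead_perm r) i
      else if i < N then 0 else C (r - N) i)"
    unfolding detf_mult by (intro detf_cong TG)
  also have "\<dots> = detf N (\<lambda>r i. G (bead_perm r) i) * detf m (\<lambda>s t. C s (N + t))"
    by (subst detf_lower_left_zero) (auto intro!: arg_cong2[of _ _ _ _ "(*)"] detf_cong)
  also have "detf m (\<lambda>s t. C s (N + t)) = 1"
    by (subst detf_lower_triangular) (auto simp: C_def F_def coeff_F fps_nth_0_prod)
  also have "detf N (\<lambda>r i. G (bead_perm r) i) = detf N (\<lambda>r i. x i ^ (p r + (N - 1 - r)))"
    by (intro detf_cong) (auto simp: G_def bead_perm_bead)
  also have "\<dots> = detf N (\<lambda>i j. x i ^ (p j + (N - 1 - j)))"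
    by (rule detf_transpose)
  finally have main: "detf N (\<lambda>i j. x i ^ (p j + (N - 1 - j))) = detf (N + m) T * detf (N + m) G"
    by simp
  have "detf (N + m) G = detf N (\<lambda>k i. x i ^ k)"
    by (subst detf_upper_right_zero) (auto simp: G_def detf_upper_triangular intro!: detf_cong)
  also have "\<dots> = detf N (\<lambda>i j. x i ^ j)"
    by (rule detf_transpose)
  finally have G: "detf (N + m) G = detf N (\<lambda>i j. x i ^ j)" .
  have sign_sq: "of_int (sign bead_perm) * (of_int (sign bead_perm) * y) = y" for y :: 'a
    by (auto simp: sign_def)
  have inj: "bead_perm i = bead_perm j \<longleftrightarrow> i = j" for i j
    using permutes_inj[OF bead_perm_permutes] by (auto dest: injD)
  \<comment> \<open>With bead columns listed before hole columns, the upper left block is the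
    identity and the block to its right is zero.\<close>
  have "detf (N + m) (\<lambda>r k. T r (bead_perm k)) = detf m (\<lambda>s t. C s (N + t - c t))"
    by (subst detf_upper_right_zero)
      (auto simp: T_def inj detf_upper_triangular bead_perm_hole intro!: detf_cong)
  then have "detf (N + m) T = of_int (sign bead_perm) * detf m (\<lambda>s t. C s (N + t - c t))"
    using detf_permute_cols[OF bead_perm_permutes, of T] sign_sq by metis
  also have "detf m (\<lambda>s t. C s (N + t - c t)) =
      detf m (\<lambda>s t. (- 1) ^ s * ((- 1) ^ (c t + t) * e (int (c t) - int t + int s)))"
  proof (intro detf_cong)
    fix s t assume "s < m" "t < m"
    consider "s \<le> N + t - c t" "t \<le> c t + s" | "s \<le> N + t - c t" "c t + s < t" | "N + t - c t < s"
      by linarith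
    then show "C s (N + t - c t) = (- 1) ^ s * ((- 1) ^ (c t + t) * e (int (c t) - int t + int s))"
    proof cases
      case 1
      define d where "d = c t + s - t"
      have d: "c t + s = d + t" "N + t - c t - s = N - d" "d \<le> N" "nat (int (c t) - int t + int s) = d"
        using 1 c_le[of t] by (auto simp: d_def)
      have "(- 1 :: 'a) ^ s * (- 1) ^ (c t + t) = (- 1) ^ d"
        using d(1) by (simp flip: power_add) (metis add.commute add.left_commute
            minus_one_power_iff even_add)
      then show ?thesis
        using 1 d by (simp add: C_def F_def coeff_F e_def E_def flip: mult.assoc)
    next
      case 2
      then show ?thesis
        by (simp add: C_def F_def coeff_F e_def)
    next
      case 3
      define d where "d = c t + s - t"
      have d: "N < d" "nat (int (c t) - int t + int s) = d"
        using 3 c_le[of t] by (auto simp: d_def)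
      then have "fps_nth (\<Prod>i<N. 1 + fps_const (x i) * fps_X) d = 0"
        by (intro fps_nth_prod_linear_eq_0) auto
      then show ?thesis
        using 3 d by (simp add: C_def e_def E_def)
    qed
  qed
  also have "\<dots> = (\<Prod>s<m. (- 1) ^ s) * ((\<Prod>t<m. (- 1) ^ (c t + t)) *
      detf m (\<lambda>s t. e (int (c t) - int t + int s)))"
    by (simp only: detf_scale_rows detf_scale_cols)
  also have "detf m (\<lambda>s t. e (int (c t) - int t + int s)) =
      detf m (\<lambda>i j. e (int (c i) - int i + int j))"
    by (rule detf_transpose)
  also have "(\<Prod>s<m. (- 1) ^ s) * ((\<Prod>t<m. (- 1) ^ (c t + t)) * y) = (\<Prod>t<m. (- 1) ^ c t) * y" for y :: 'a
  proof -
    have "(\<Prod>s<m. (- 1) ^ s) * (\<Prod>t<m. (- 1) ^ (c t + t)) = (\<Prod>t<m. (- 1 :: 'a) ^ c t)"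
      unfolding prod.distrib[symmetric] by (intro prod.cong refl) (auto simp: minus_one_power_iff)
    then show ?thesis
      by (simp only: mult.assoc[symmetric])
  qed
  finally have "detf (N + m) T = of_int (sign bead_perm) * ((\<Prod>t<m. (- 1) ^ c t) *
      detf m (\<lambda>i j. e (int (c i) - int i + int j)))" .
  \<comment> \<open>The signs (-1)^(c t) from the coefficients of F cancel against the bead-hole
    inversions; what remains is the sign of reversing N columns.\<close>
  moreover have "of_int (sign bead_perm) * (\<Prod>t<m. (- 1 :: 'a) ^ c t) = (\<Prod>i<N. \<Prod>j<i. - 1)"
    by (simp add: sign_bead_perm of_int_prod mult.assoc flip: prod.distrib power_add)
  ultimately show ?thesis
    unfolding main G by (simp flip: mult.assoc)
qed

end

text \<open>The case of the empty partition in a box of width 0 supplies the reversal sign between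
  the exponents j and N-1-j, which removes it from the general case.\<close>

lemma dual_jacobi_trudi:
  fixes x :: "nat \<Rightarrow> 'a::idom" and p c :: "nat \<Rightarrow> nat"
  assumes p: "\<And>i i'. i \<le> i' \<Longrightarrow> p i' \<le> p i" "\<And>i. p i \<le> m"
    and c: "\<And>j. c j = card {i \<in> {..<N}. j < p i}"
  defines "E \<equiv> (\<Prod>i<N. 1 + fps_const (x i) * fps_X)"
  shows "detf m (\<lambda>i j. let k = int (c i) - int i + int j in if k < 0 then 0 else fps_nth E (nat k)) *
      detf N (\<lambda>i j. x i ^ (N - 1 - j)) = detf N (\<lambda>i j. x i ^ (p j + (N - 1 - j)))"
  using dual_jacobi_trudi_aux[of p m c N x, OF p c] dual_jacobi_trudi_aux[of "\<lambda>_. 0" 0 "\<lambda>_. 0" N x]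
  unfolding E_def Let_def by simp

section \<open>Minors of the matrix $(q^{ab})$\<close>

lemma partition_of_fun:
  assumes anti: "\<And>i. f (Suc i) \<le> f i" and zero: "\<And>i. N \<le> i \<Longrightarrow> f i = 0"
  shows "\<exists>\<rho>. plength \<rho> \<le> N \<and> (\<forall>i. part \<rho> (Suc i) = f i)"
proof -
  define n where "n = (LEAST n. f n = 0)"
  have "f n = 0" and "n \<le> N"
    unfolding n_def using zero[of N] by (auto intro: LeastI Least_le)
  have mono: "f j \<le> f i" if "i \<le> j" for i j
    using anti that by (rule lift_Suc_antimono_le)
  have pos: "f i \<noteq> 0" if "i < n" for i
    using that not_less_Least unfolding n_def by blast
  have "0 \<notin> set (map f [0..<n])"
  proof
    assume "0 \<in> set (map f [0..<n])"
    then obtain i where "i < n" "f i = 0"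
      by auto
    then show False
      using pos by blast
  qed
  then have parts: "parts (Partition (map f [0..<n])) = map f [0..<n]"
    using mono by (intro Partition_inverse) (auto simp: sorted_wrt_iff_nth_less)
  have "part (Partition (map f [0..<n])) (Suc i) = f i" for i
    using mono[of n i] \<open>f n = 0\<close> by (auto simp: part_def parts)
  then show ?thesis
    using \<open>n \<le> N\<close> by (intro exI[of _ "Partition (map f [0..<n])"]) (simp add: plength_def parts)
qed

text \<open>The beta-numbers of \<rho>, that is, the exponents in the bialternant formula; i counts
  from 0 although \<open>part\<close> counts from 1.\<close>

definition beads :: "nat \<Rightarrow> partition \<Rightarrow> nat \<Rightarrow> nat" where
  "beads N \<rho> i = part \<rho> (i + 1) + (N - 1 - i)"

definition box_partitions :: "nat \<Rightarrow> nat \<Rightarrow> partition set" where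
  "box_partitions N m = {\<rho>. plength \<rho> \<le> N \<and> part \<rho> 1 \<le> m}"

lemma beads_strict_antimono: "i < j \<Longrightarrow> j < N \<Longrightarrow> beads N \<rho> j < beads N \<rho> i"
  using part_antimono[of "i + 1" "j + 1" \<rho>] by (simp add: beads_def)

lemma inj_on_beads: "inj_on (beads N \<rho>) {..<N}"
proof (rule inj_onI)
  fix i j assume "i \<in> {..<N}" "j \<in> {..<N}" "beads N \<rho> i = beads N \<rho> j"
  then show "i = j"
    using beads_strict_antimono[of i j N \<rho>] beads_strict_antimono[of j i N \<rho>]
    by (cases i j rule: linorder_cases) auto
qed

text \<open>Listing a subset in decreasing order and subtracting the staircase N-1-i recovers the
  partition; the difference is nonnegative because N-1-i smaller elements follow. This provides the
  index set for Cauchy-Binet.\<close>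

lemma bij_betw_beads:
  "bij_betw (\<lambda>\<rho>. beads N \<rho> ` {..<N}) (box_partitions N m) {K. K \<subseteq> {..<N + m} \<and> card K = N}"
  unfolding bij_betw_def
proof (intro conjI inj_onI equalityI subsetI)
  fix \<rho> \<sigma> assume \<rho>: "\<rho> \<in> box_partitions N m" and \<sigma>: "\<sigma> \<in> box_partitions N m"
    and eq: "beads N \<rho> ` {..<N} = beads N \<sigma> ` {..<N}"
  have beads_eq: "beads N \<rho> i = beads N \<sigma> i" if "i < N" for i
    using beads_strict_antimono beads_strict_antimono eq that by (rule strictly_decreasing_image_eq)
  have "part \<rho> (Suc i) = part \<sigma> (Suc i)" for i
    using part_0[of \<rho> "Suc i"] part_0[of \<sigma> "Suc i"] \<rho> \<sigma> beads_eq[of i]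
    by (cases "i < N") (auto simp: beads_def box_partitions_def)
  then show "\<rho> = \<sigma>"
    by (intro partition_eqI) (metis Suc_le_D One_nat_def)
next
  fix K assume "K \<in> (\<lambda>\<rho>. beads N \<rho> ` {..<N}) ` box_partitions N m"
  then obtain \<rho> where \<rho>: "plength \<rho> \<le> N" "part \<rho> 1 \<le> m" and K: "K = beads N \<rho> ` {..<N}"
    by (auto simp: box_partitions_def)
  have "beads N \<rho> i < N + m" if "i < N" for i
    using part_antimono[of 1 "i + 1" \<rho>] \<rho> that by (simp add: beads_def)
  then show "K \<in> {K. K \<subseteq> {..<N + m} \<and> card K = N}"
    by (auto simp: K card_image inj_on_beads)
next
  fix K assume "K \<in> {K. K \<subseteq> {..<N + m} \<and> card K = N}"
  then have K: "K \<subseteq> {..<N + m}" "card K = N" and fin: "finite K"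
    using finite_subset[of K "{..<N + m}"] by auto
  define xs where "xs = sorted_list_of_set K"
  have len: "length xs = N" and set_xs: "set xs = K"
    using K fin by (auto simp: xs_def)
  define u where "u i = xs ! (N - 1 - i)" for i
  have u_less: "u j < u i" if "i < j" "j < N" for i j
  proof -
    have "sorted_wrt (<) xs"
      by (simp add: xs_def)
    then show ?thesis
      using that len by (auto simp: u_def sorted_wrt_iff_nth_less)
  qed
  have u_im: "u ` {..<N} = K"
  proof -
    have "u ` {..<N} = (\<lambda>i. xs ! i) ` {..<N}"
    proof (intro equalityI subsetI)
      fix y assume "y \<in> (\<lambda>i. xs ! i) ` {..<N}"
      then obtain i where "i < N" "y = xs ! i"
        by auto
      then show "y \<in> u ` {..<N}"
        by (intro image_eqI[of _ _ "N - 1 - i"]) (auto simp: u_def)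
    qed (auto simp: u_def)
    then show ?thesis
      using len set_xs by (auto simp: set_conv_nth)
  qed
  have u_ge: "N - 1 - i \<le> u i" if "i < N" for i
    using that
  proof (induction "N - 1 - i" arbitrary: i)
    case (Suc d)
    then have "N - 1 - Suc i \<le> u (Suc i)"
      by (intro Suc.hyps) auto
    then show ?case
      using u_less[of i "Suc i"] Suc by linarith
  qed auto
  define f where "f i = (if i < N then u i - (N - 1 - i) else 0)" for i
  have "f (Suc i) \<le> f i" for i
    using u_less[of i "Suc i"] u_ge[of "Suc i"] by (auto simp: f_def)
  moreover have "f i = 0" if "N \<le> i" for i
    using that by (simp add: f_def)
  ultimately obtain \<rho> where \<rho>: "plength \<rho> \<le> N" "\<And>i. part \<rho> (Suc i) = f i"
    using partition_of_fun[of f N] by blast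
  have beads: "beads N \<rho> i = u i" if "i < N" for i
    using that u_ge[OF that] by (simp add: beads_def \<rho> f_def)
  have "part \<rho> 1 \<le> m"
  proof (cases "0 < N")
    case True
    then have "u 0 < N + m"
      using K(1) u_im by blast
    moreover have "part \<rho> 1 = u 0 - (N - 1)"
      using \<rho>(2)[of 0] True by (simp add: f_def)
    ultimately show ?thesis
      using True by linarith
  qed (use \<rho>(2)[of 0] in \<open>simp add: f_def\<close>)
  then have "\<rho> \<in> box_partitions N m"
    using \<rho>(1) by (simp add: box_partitions_def)
  moreover have "K = beads N \<rho> ` {..<N}"
    using beads u_im by auto
  ultimately show "K \<in> (\<lambda>\<rho>. beads N \<rho> ` {..<N}) ` box_partitions N m"
    by blast
qed

lemma finite_box_partitions: "finite (box_partitions N m)"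
proof -
  have "finite {K. K \<subseteq> {..<N + m} \<and> card K = N}"
    by (rule finite_subset[of _ "Pow {..<N + m}"]) auto
  then show ?thesis
    using bij_betw_finite[OF bij_betw_beads] by blast
qed

lemma detf_vandermonde_rev:
  fixes x :: "nat \<Rightarrow> 'a::idom"
  shows "detf n (\<lambda>i j. x i ^ (n - 1 - j)) = (\<Prod>i<n. \<Prod>j<i. x j - x i)"
proof -
  have "detf n (\<lambda>i j. x i ^ (n - 1 - j)) = (\<Prod>i<n. \<Prod>j<i. - 1) * (\<Prod>i<n. \<Prod>j<i. x i - x j)"
    using dual_jacobi_trudi_aux[of "\<lambda>_. 0" 0 "\<lambda>_. 0" n x] by (simp add: detf_vandermonde)
  also have "\<dots> = (\<Prod>i<n. \<Prod>j<i. - 1 * (x i - x j))"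
    by (simp only: prod.distrib)
  finally show ?thesis
    by simp
qed

section \<open>Specialization at (1, q, q^2, ...)\<close>

locale not_root_of_unity =
  fixes q :: "'a::field_char_0"
  assumes q_nz: "q \<noteq> 0" and q_pow: "\<And>n. n \<ge> 1 \<Longrightarrow> q ^ n \<noteq> 1"
begin

definition qfact :: "nat \<Rightarrow> 'a" where
  "qfact n = (\<Prod>i<n. 1 - q ^ Suc i)"

definition hq :: "int \<Rightarrow> 'a" where
  "hq n = (if n < 0 then 0 else inverse (qfact (nat n)))"

lemma q_pow_Suc: "q ^ Suc n \<noteq> 1"
  by (rule q_pow) simp

lemma qfact_nz: "qfact n \<noteq> 0"
  using q_pow_Suc by (auto simp: qfact_def)

lemma q_pow_inj: "q ^ m = q ^ n \<longleftrightarrow> m = n"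
proof -
  have "q ^ m \<noteq> q ^ n" if "m < n" for m n
  proof
    assume "q ^ m = q ^ n"
    moreover have "q ^ n = q ^ m * q ^ (n - m)"
      using that by (simp flip: power_add)
    ultimately have "q ^ m * q ^ (n - m) = q ^ m"
      by simp
    then have "q ^ (n - m) = 1"
      using q_nz by simp
    then show False
      using q_pow[of "n - m"] that by simp
  qed
  then show ?thesis
    by (metis linorder_neqE_nat)
qed

lemma principal_value_complete_sym: "principal_value q (complete_sym n) = hq n"
proof -
  have "(\<Prod>i = 1..k. inverse (1 - q ^ i)) = inverse (qfact k)" for k
    by (simp add: qfact_def prod.atLeast1_atMost_eq prod_inversef[symmetric] comp_def)
  then show ?thesis
    by (auto simp: principal_value_def specialize_complete_sym hq_def qfact_def)
qed

lemma principal_value_schur: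
  assumes "plength \<mu> \<le> n"
  shows "principal_value q (schur \<mu>) = detf n (\<lambda>i j. hq (int (part \<mu> (i + 1)) - int i + int j))"
  unfolding schur_eq_detf[OF assms] principal_value_def specialize.hom_detf
  by (simp only: principal_value_complete_sym[unfolded principal_value_def])

text \<open>Staircase terms cancel in differences of beads, so the value is a minor of the Toeplitz
  matrix \<open>hq\<close> (a - b) with rows at the beads of \<mu> and columns at those of \<rho>.
  Cauchy-Binet produces minors of this shape.\<close>

lemma principal_value_skew_schur:
  assumes "plength \<mu> \<le> n" "plength \<rho> \<le> n"
  shows "principal_value q (skew_schur \<mu> \<rho>) = detf n (\<lambda>i j. hq (int (beads n \<mu> i) - int (beads n \<rho> j)))"
proof -
  have "principal_value q (skew_schur \<mu> \<rho>) =
      detf n (\<lambda>i j. hq (int (part \<mu> (i + 1)) - int (part \<rho> (j + 1)) - int i + int j))"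
    unfolding skew_schur_eq_detf[OF assms] principal_value_def specialize.hom_detf
    by (simp only: principal_value_complete_sym[unfolded principal_value_def])
  also have "\<dots> = detf n (\<lambda>i j. hq (int (beads n \<mu> i) - int (beads n \<rho> j)))"
    by (intro detf_cong arg_cong[of _ _ hq]) (auto simp: beads_def)
  finally show ?thesis .
qed

lemma hq_neg: "n < 0 \<Longrightarrow> hq n = 0"
  by (simp add: hq_def)

text \<open>If \<rho> is too long the last row vanishes, if it is too wide the first column does.
  These two bounds confine the sum over \<rho> to a box.\<close>

lemma principal_value_skew_schur_eq_0:
  assumes "plength \<mu> < plength \<rho> \<or> part \<mu> 1 < part \<rho> 1"
  shows "principal_value q (skew_schur \<mu> \<rho>) = 0"
  using assms
proof
  assume less: "plength \<mu> < plength \<rho>"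
  let ?n = "plength \<rho>"
  have pos: "part \<rho> (j + 1) > 0" if "j < ?n" for j
    using part_pos_iff[of "j + 1" \<rho>] that by simp
  have "hq (int (beads ?n \<mu> (?n - 1)) - int (beads ?n \<rho> j)) = 0" if "j < ?n" for j
    using less that pos[OF that] by (intro hq_neg) (auto simp: beads_def part_0)
  then show ?thesis
    unfolding principal_value_skew_schur[OF less_imp_le[OF less] order.refl]
    using less by (intro detf_zero_row[of "?n - 1"]) auto
next
  assume less: "part \<mu> 1 < part \<rho> 1"
  define n where "n = max (plength \<mu>) (plength \<rho>)"
  have "0 < n"
    using less part_0[of \<rho> 1] by (force simp: n_def)
  have "hq (int (beads n \<mu> i) - int (beads n \<rho> 0)) = 0" for i
    using less part_antimono[of 1 "i + 1" \<mu>] by (intro hq_neg) (auto simp: beads_def)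
  then show ?thesis
    using principal_value_skew_schur[of \<mu> n \<rho>] \<open>0 < n\<close>
    by (simp add: n_def detf_zero_col[of 0])
qed

text \<open>In closed form (-1)^k q^(k(k-1)/2) / (q)_k. The denominator comes from the q-binomial
  coefficient of b over k, the rest from pulling q^i out of each factor q^a - q^i.\<close>

definition qdiag :: "nat \<Rightarrow> 'a" where
  "qdiag k = (\<Prod>i<k. - (q ^ i) / (1 - q ^ Suc i))"

lemma qdiag_Suc: "qdiag (Suc k) * (1 - q ^ Suc k) = - (q ^ k) * qdiag k"
  using q_pow_Suc[of k] by (simp add: qdiag_def field_simps)

lemma qdiag_nz: "qdiag k \<noteq> 0"
  using q_pow_Suc q_nz by (auto simp: qdiag_def)

text \<open>The $q$-binomial expansion of $x^b$ at $x = q^a$ in the basis $\prod_{i<k} (x - q^i)$.\<close>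

lemma q_pow_mult_expand:
  assumes "b < m"
  shows "q ^ (a * b) = qfact a * (qfact b * (\<Sum>k<m. hq (int a - int k) * (qdiag k * hq (int b - int k))))"
proof -
  \<comment> \<open>The q-falling factorial (q)_n / (q)_(n-k), which vanishes for k > n by the
    convention for \<open>hq\<close>.\<close>
  define A where "A n k = qfact n * hq (int n - int k)" for n k
  have A_0: "A n 0 = 1" for n
    by (simp add: A_def hq_def qfact_nz)
  have A_zero: "A n k = 0" if "n < k" for n k
    using that by (simp add: A_def hq_neg)
  have A_Suc: "A n k = A n (Suc k) + q ^ (n - k) * A n k" if "k \<le> n" for n k
  proof (cases "k = n")
    case False
    then obtain d where d: "n = Suc (k + d)"
      using \<open>k \<le> n\<close> less_natE[of k n] by auto
    have "qfact (Suc d) = qfact d * (1 - q ^ Suc d)"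
      by (simp add: qfact_def)
    then have "inverse (qfact d) = inverse (qfact (Suc d)) * (1 - q ^ Suc d)"
      using q_pow_Suc[of d] qfact_nz[of d] qfact_nz[of "Suc d"]
      by (simp add: field_simps)
    moreover have "hq (int n - int k) = inverse (qfact (Suc d))"
      "hq (int n - int (Suc k)) = inverse (qfact d)" "n - k = Suc d"
      using d by (simp_all add: hq_def nat_add_distrib)
    ultimately have "hq (int n - int (Suc k)) = hq (int n - int k) * (1 - q ^ (n - k))"
      by (simp only:)
    then show ?thesis
      unfolding A_def by (simp only: ring_distribs mult_1_right mult_ac) simp
  qed (simp add: A_zero)
  have shift: "q ^ n * A n k = q ^ k * (A n k - A n (Suc k))" for n k
  proof (cases "k \<le> n")
    case True
    then have "q ^ n = q ^ k * q ^ (n - k)"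
      by (simp flip: power_add)
    moreover have "A n k - A n (Suc k) = q ^ (n - k) * A n k"
      using A_Suc[OF True] by (metis add_diff_cancel_left')
    ultimately show ?thesis
      by simp
  qed (simp add: A_zero)
  have A_Suc_Suc: "A (Suc n) (Suc k) = (1 - q ^ Suc n) * A n k" for n k
    by (simp add: A_def qfact_def)
  have pascal: "A (Suc n) (Suc k) = q ^ Suc k * A n (Suc k) + (1 - q ^ Suc k) * A n k" for n k
  proof -
    have "q * (q ^ n * A n k) = q * (q ^ k * (A n k - A n (Suc k)))"
      by (simp only: shift)
    then show ?thesis
      unfolding A_Suc_Suc by (simp add: algebra_simps)
  qed
  have main: "q ^ (a * b) = (\<Sum>k\<le>b. qdiag k * A a k * A b k)"
  \<comment> \<open>Passing from b to b + 1 multiplies by q^a; \<open>shift\<close> splits each term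
    between k and k + 1, and \<open>pascal\<close> with \<open>qdiag_Suc\<close> recombines the
    pieces.\<close>
  proof (induction b)
    case 0
    show ?case
      by (simp add: A_0 qdiag_def)
  next
    case (Suc b)
    have "q ^ (a * Suc b) = (\<Sum>k\<le>b. qdiag k * (q ^ a * A a k) * A b k)"
      by (simp add: power_add Suc.IH sum_distrib_left mult_ac)
    also have "\<dots> = (\<Sum>k\<le>b. qdiag k * q ^ k * A a k * A b k) - (\<Sum>k\<le>b. qdiag k * q ^ k * A a (Suc k) * A b k)"
      unfolding shift by (simp add: sum_subtractf algebra_simps)
    also have "(\<Sum>k\<le>b. qdiag k * q ^ k * A a k * A b k) = (\<Sum>k\<le>Suc b. qdiag k * q ^ k * A a k * A b k)"
      by (simp add: A_zero)
    also have "\<dots> = 1 + (\<Sum>k\<le>b. qdiag (Suc k) * q ^ Suc k * A a (Suc k) * A b (Suc k))"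
      by (subst sum.atMost_Suc_shift) (simp add: A_0 qdiag_def)
    also have "1 + (\<Sum>k\<le>b. qdiag (Suc k) * q ^ Suc k * A a (Suc k) * A b (Suc k)) -
        (\<Sum>k\<le>b. qdiag k * q ^ k * A a (Suc k) * A b k) =
        1 + (\<Sum>k\<le>b. qdiag (Suc k) * A a (Suc k) * A (Suc b) (Suc k))"
    proof -
      have "qdiag (Suc k) * q ^ Suc k * A a (Suc k) * A b (Suc k) - qdiag k * q ^ k * A a (Suc k) * A b k =
          qdiag (Suc k) * A a (Suc k) * A (Suc b) (Suc k)" for k
      proof -
        have "qdiag (Suc k) * A a (Suc k) * A (Suc b) (Suc k) =
            qdiag (Suc k) * q ^ Suc k * A a (Suc k) * A b (Suc k) +
            (qdiag (Suc k) * (1 - q ^ Suc k)) * (A a (Suc k) * A b k)"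
          unfolding pascal by (simp only: ring_distribs mult_ac)
        then show ?thesis
          unfolding qdiag_Suc by (simp add: mult_ac)
      qed
      then show ?thesis
        by (simp only: add_diff_eq[symmetric] sum_subtractf[symmetric])
    qed
    also have "\<dots> = (\<Sum>k\<le>Suc b. qdiag k * A a k * A (Suc b) k)"
      by (subst sum.atMost_Suc_shift) (simp add: A_0 qdiag_def)
    finally show ?case .
  qed
  also have "\<dots> = (\<Sum>k<m. qdiag k * A a k * A b k)"
    using assms by (intro sum.mono_neutral_left) (auto simp: A_zero)
  finally show ?thesis
    by (simp add: A_def sum_distrib_left mult_ac)
qed

definition skew_sum :: "nat \<Rightarrow> nat \<Rightarrow> partition \<Rightarrow> partition \<Rightarrow> (partition \<Rightarrow> 'a) \<Rightarrow> 'a" where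
  "skew_sum N m \<mu> \<nu> w = (\<Sum>\<rho>\<in>box_partitions N m.
     w \<rho> * principal_value q (skew_schur \<mu> \<rho>) * principal_value q (skew_schur \<nu> \<rho>))"

lemma detf_q_pow_beads:
  assumes "plength \<mu> \<le> N" "plength \<nu> \<le> N" "part \<nu> 1 \<le> m"
  shows "detf N (\<lambda>i j. q ^ (beads N \<mu> i * beads N \<nu> j)) =
    (\<Prod>i<N. qfact (beads N \<mu> i)) * ((\<Prod>j<N. qfact (beads N \<nu> j)) *
      skew_sum N m \<mu> \<nu> (\<lambda>\<rho>. \<Prod>l<N. qdiag (beads N \<rho> l)))"
proof -
  let ?a = "beads N \<mu>" and ?b = "beads N \<nu>"
  let ?A = "\<lambda>i k. hq (int (?a i) - int k)" and ?B = "\<lambda>k j. qdiag k * hq (int (?b j) - int k)"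
  \<comment> \<open>This bound allows one summation range, k < N + m, for all entries, so that the
    matrix is a product.\<close>
  have "?b j < N + m" if "j < N" for j
    using part_antimono[of 1 "j + 1" \<nu>] assms(3) that by (simp add: beads_def)
  then have "detf N (\<lambda>i j. q ^ (?a i * ?b j)) =
      detf N (\<lambda>i j. qfact (?a i) * (qfact (?b j) * (\<Sum>k<N + m. ?A i k * ?B k j)))"
    by (intro detf_cong q_pow_mult_expand)
  also have "\<dots> = (\<Prod>i<N. qfact (?a i)) * ((\<Prod>j<N. qfact (?b j)) *
      detf N (\<lambda>i j. \<Sum>k<N + m. ?A i k * ?B k j))"
    by (simp only: detf_scale_rows detf_scale_cols)
  also have "detf N (\<lambda>i j. \<Sum>k<N + m. ?A i k * ?B k j) = (\<Sum>\<rho>\<in>box_partitions N m.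
      detf N (\<lambda>i j. ?A i (beads N \<rho> j)) * detf N (\<lambda>i j. ?B (beads N \<rho> i) j))"
    using inj_on_beads bij_betw_beads by (intro cauchy_binet)
  also have "\<dots> = skew_sum N m \<mu> \<nu> (\<lambda>\<rho>. \<Prod>l<N. qdiag (beads N \<rho> l))"
    unfolding skew_sum_def
  proof (intro sum.cong refl)
    fix \<rho> assume "\<rho> \<in> box_partitions N m"
    then have len: "plength \<rho> \<le> N"
      by (simp add: box_partitions_def)
    have "detf N (\<lambda>i j. ?B (beads N \<rho> i) j) = (\<Prod>l<N. qdiag (beads N \<rho> l)) *
        detf N (\<lambda>i j. hq (int (?b j) - int (beads N \<rho> i)))"
      by (rule detf_scale_rows)
    also have "detf N (\<lambda>i j. hq (int (?b j) - int (beads N \<rho> i))) =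
        detf N (\<lambda>i j. hq (int (?b i) - int (beads N \<rho> j)))"
      by (rule detf_transpose)
    finally show "detf N (\<lambda>i j. ?A i (beads N \<rho> j)) * detf N (\<lambda>i j. ?B (beads N \<rho> i) j) =
        (\<Prod>l<N. qdiag (beads N \<rho> l)) * principal_value q (skew_schur \<mu> \<rho>) *
        principal_value q (skew_schur \<nu> \<rho>)"
      by (simp only: principal_value_skew_schur[OF assms(1) len]
            principal_value_skew_schur[OF assms(2) len] mult_ac)
  qed
  finally show ?thesis .
qed

lemma parts_empty: "parts (Partition []) = []"
  by (rule Partition_inverse) simp

lemma part_empty [simp]: "part (Partition []) i = 0" and plength_empty [simp]: "plength (Partition []) = 0"
  by (simp_all add: part_def plength_def parts_empty)

lemma beads_empty: "beads N (Partition []) j = N - 1 - j"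
  by (simp add: beads_def)

lemma skew_sum_empty:
  assumes "plength \<mu> \<le> N"
  shows "skew_sum N m \<mu> (Partition []) w = w (Partition []) * principal_value q (schur \<mu>)"
proof -
  have "principal_value q (skew_schur (Partition []) \<rho>) = 0" if "\<rho> \<noteq> Partition []" for \<rho>
  proof (rule principal_value_skew_schur_eq_0)
    have "0 < plength \<rho>"
    proof (rule ccontr)
      assume "\<not> 0 < plength \<rho>"
      then have "\<rho> = Partition []"
        by (intro partition_eqI) (simp add: part_0)
      then show False
        using that by simp
    qed
    then show "plength (Partition []) < plength \<rho> \<or> part (Partition []) 1 < part \<rho> 1"
      by simp
  qed
  then have "skew_sum N m \<mu> (Partition []) w = (\<Sum>\<rho>\<in>{Partition []}.
      w \<rho> * principal_value q (skew_schur \<mu> \<rho>) * principal_value q (skew_schur (Partition []) \<rho>))"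
    unfolding skew_sum_def
    by (intro sum.mono_neutral_right finite_box_partitions) (auto simp: box_partitions_def)
  moreover have "principal_value q (skew_schur (Partition []) (Partition [])) = 1"
    by (subst principal_value_skew_schur[of _ 0]) auto
  moreover have "principal_value q (skew_schur \<mu> (Partition [])) = principal_value q (schur \<mu>)"
    unfolding principal_value_schur[OF assms] principal_value_skew_schur[OF assms, of "Partition []", simplified]
    by (intro detf_cong arg_cong[of _ _ hq]) (auto simp: beads_def)
  ultimately show ?thesis
    by simp
qed

text \<open>For empty \<nu> the minor is a Vandermonde determinant and only the empty \<rho>
  survives on the other side. The result is the product formula for s_\<mu>(1, q, ...), which also
  shows that this value is nonzero.\<close>

lemma detf_q_pow_vandermonde:
  assumes "plength \<mu> \<le> N"
  shows "(\<Prod>i<N. \<Prod>j<i. q ^ beads N \<mu> j - q ^ beads N \<mu> i) =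
    (\<Prod>i<N. qfact (beads N \<mu> i)) * ((\<Prod>j<N. qfact (N - 1 - j)) *
      ((\<Prod>l<N. qdiag (N - 1 - l)) * principal_value q (schur \<mu>)))"
    and "detf N (\<lambda>i j. q ^ (beads N \<mu> i * (N - 1 - j))) =
      (\<Prod>i<N. \<Prod>j<i. q ^ beads N \<mu> j - q ^ beads N \<mu> i)"
proof -
  show *: "detf N (\<lambda>i j. q ^ (beads N \<mu> i * (N - 1 - j))) =
      (\<Prod>i<N. \<Prod>j<i. q ^ beads N \<mu> j - q ^ beads N \<mu> i)"
    using detf_vandermonde_rev[of N "\<lambda>i. q ^ beads N \<mu> i"] by (simp add: power_mult)
  show "(\<Prod>i<N. \<Prod>j<i. q ^ beads N \<mu> j - q ^ beads N \<mu> i) =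
    (\<Prod>i<N. qfact (beads N \<mu> i)) * ((\<Prod>j<N. qfact (N - 1 - j)) *
      ((\<Prod>l<N. qdiag (N - 1 - l)) * principal_value q (schur \<mu>)))"
    unfolding *[symmetric]
    using detf_q_pow_beads[OF assms, of "Partition []" 0]
    by (simp add: skew_sum_empty[OF assms] beads_empty)
qed

lemma q_vandermonde_nz: "(\<Prod>i<N. \<Prod>j<i. q ^ beads N \<mu> j - q ^ beads N \<mu> i) \<noteq> 0"
proof -
  have "beads N \<mu> j \<noteq> beads N \<mu> i" if "i < N" "j < i" for i j
    using beads_strict_antimono[OF that(2,1), of \<mu>] by simp
  then show ?thesis
    by (auto simp: q_pow_inj)
qed

lemma principal_value_schur_nz: "principal_value q (schur \<mu>) \<noteq> 0"
  using detf_q_pow_vandermonde(1)[of \<mu> "plength \<mu>"] q_vandermonde_nz[of "plength \<mu>" \<mu>] by auto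

end

section \<open>Contents and polynomial functions\<close>

lemma psize_eq_sum: "plength \<mu> \<le> n \<Longrightarrow> psize \<mu> = (\<Sum>i<n. part \<mu> (i + 1))"
  unfolding psize_def sum.atLeast1_atMost_eq[unfolded One_nat_def[symmetric]]
  by (simp only: Suc_eq_plus1, intro sum.mono_neutral_left) (auto simp: part_0)

lemma kappa_eq_sum: "plength \<mu> \<le> n \<Longrightarrow>
    kappa \<mu> = (\<Sum>i<n. int (part \<mu> (i + 1)) * (int (part \<mu> (i + 1)) - 2 * int (i + 1) + 1))"
  unfolding kappa_def sum.atLeast1_atMost_eq[unfolded One_nat_def[symmetric]]
  by (simp only: Suc_eq_plus1, intro sum.mono_neutral_left) (auto simp: part_0)

text \<open>Counting from 0, the box in row i and column v has content v - i, and \<kappa> is twice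
  the sum of contents; \<open>gauss\<close> sums one row.\<close>

lemma prod_contents:
  fixes c :: "'a::field"
  assumes "c \<noteq> 0" "plength \<mu> \<le> n"
  shows "(\<Prod>i<n. \<Prod>v<part \<mu> (i + 1). c powi (int v - int i)) = c powi (kappa \<mu> div 2)"
proof -
  have powi_sum: "(\<Prod>x\<in>A. c powi f x) = c powi (\<Sum>x\<in>A. f x)" for A and f :: "nat \<Rightarrow> int"
    using assms(1) by (induction A rule: infinite_finite_induct) (auto simp: power_int_add)
  have gauss: "2 * (\<Sum>v<p. int v - i) = int p * (int p - 2 * (i + 1) + 1)" for p i
    by (induction p) (auto simp: algebra_simps)
  have "kappa \<mu> = 2 * (\<Sum>i<n. \<Sum>v<part \<mu> (i + 1). int v - int i)"
    unfolding kappa_eq_sum[OF assms(2)] by (simp only: sum_distrib_left[of 2 _ "{..<n}"] gauss) simp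
  then show ?thesis
    by (simp add: powi_sum)
qed

lemma prod_minus_contents:
  fixes c :: "'a::field"
  assumes "c \<noteq> 0" "plength \<mu> \<le> n"
  shows "(\<Prod>i<n. \<Prod>v<part \<mu> (i + 1). - (c powi (int v - int i))) =
    (- 1) ^ psize \<mu> * c powi (kappa \<mu> div 2)"
proof -
  have "(\<Prod>i<n. \<Prod>v<part \<mu> (i + 1). - (c powi (int v - int i))) =
      (\<Prod>i<n. (- 1) ^ part \<mu> (i + 1)) * (\<Prod>i<n. \<Prod>v<part \<mu> (i + 1). c powi (int v - int i))"
    by (simp add: prod_uminus prod.distrib)
  then show ?thesis
    by (simp only: prod_contents[OF assms] psize_eq_sum[OF assms(2)] power_sum)
qed

text \<open>Polynomiality is a property of functions here, so that determinants and products are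
  handled by closure rules without exhibiting a polynomial.\<close>

definition polyfun :: "('a::comm_ring_1 \<Rightarrow> 'a) \<Rightarrow> bool" where
  "polyfun f \<longleftrightarrow> (\<exists>p. \<forall>z. f z = poly p z)"

lemma polyfun_const: "polyfun (\<lambda>_. c)"
  unfolding polyfun_def by (intro exI[of _ "[:c:]"]) simp

lemma polyfun_id: "polyfun (\<lambda>z. z)"
  unfolding polyfun_def by (intro exI[of _ "[:0, 1:]"]) simp

lemma polyfun_add: "polyfun f \<Longrightarrow> polyfun g \<Longrightarrow> polyfun (\<lambda>z. f z + g z)"
  unfolding polyfun_def by (elim exE, rule_tac x = "p + pa" in exI) simp

lemma polyfun_diff: "polyfun f \<Longrightarrow> polyfun g \<Longrightarrow> polyfun (\<lambda>z. f z - g z)"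
  unfolding polyfun_def by (elim exE, rule_tac x = "p - pa" in exI) simp

lemma polyfun_mult: "polyfun f \<Longrightarrow> polyfun g \<Longrightarrow> polyfun (\<lambda>z. f z * g z)"
  unfolding polyfun_def by (elim exE, rule_tac x = "p * pa" in exI) simp

lemma polyfun_sum: "(\<And>x. x \<in> A \<Longrightarrow> polyfun (f x)) \<Longrightarrow> polyfun (\<lambda>z. \<Sum>x\<in>A. f x z)"
  by (induction A rule: infinite_finite_induct) (auto intro: polyfun_const polyfun_add)

lemma polyfun_prod: "(\<And>x. x \<in> A \<Longrightarrow> polyfun (f x)) \<Longrightarrow> polyfun (\<lambda>z. \<Prod>x\<in>A. f x z)"
  by (induction A rule: infinite_finite_induct) (auto intro: polyfun_const polyfun_mult)

lemma polyfun_detf: "(\<And>i j. polyfun (f i j)) \<Longrightarrow> polyfun (\<lambda>z. detf n (\<lambda>i j. f i j z))"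
  unfolding detf_altdef by (intro polyfun_sum polyfun_mult polyfun_prod polyfun_const)

lemma polyfun_eqI:
  fixes f g :: "'a::idom \<Rightarrow> 'a"
  assumes "polyfun f" "polyfun g" "infinite {z. f z = g z}"
  shows "f z = g z"
proof -
  obtain p where p: "\<And>z. f z - g z = poly p z"
    using polyfun_diff[OF assms(1,2)] by (auto simp: polyfun_def)
  have "{z. f z = g z} = {z. poly p z = 0}"
    by (simp flip: p)
  then have "p = 0"
    using assms(3) poly_roots_finite by metis
  then show ?thesis
    using p[of z] by simp
qed

section \<open>Conjugates and series with finitely many variables\<close>

lemma schur_fps_eq_detf: "schur_fps \<nu> E = detf (plength (Defs.conjugate \<nu>)) (\<lambda>i j.
    let k = int (part (Defs.conjugate \<nu>) (i + 1)) - int i + int j in if k < 0 then 0 else fps_nth E (nat k))"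
  unfolding schur_fps_def detf_def Let_def ..

lemma plength_conjugate: "plength (Defs.conjugate \<nu>) = part \<nu> 1"
  by (simp add: plength_def parts_conjugate)

lemma part_conjugate:
  assumes "plength \<nu> \<le> N"
  shows "part (Defs.conjugate \<nu>) (Suc j) = card {i \<in> {..<N}. j < part \<nu> (Suc i)}"
proof -
  have "{i \<in> {1..plength \<nu>}. Suc j \<le> part \<nu> i} = Suc ` {i \<in> {..<N}. j < part \<nu> (Suc i)}"
  proof (intro equalityI subsetI)
    fix k assume "k \<in> {i \<in> {1..plength \<nu>}. Suc j \<le> part \<nu> i}"
    then show "k \<in> Suc ` {i \<in> {..<N}. j < part \<nu> (Suc i)}"
      using assms by (intro image_eqI[of _ _ "k - 1"]) auto
  next
    fix k assume "k \<in> Suc ` {i \<in> {..<N}. j < part \<nu> (Suc i)}"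
    then show "k \<in> {i \<in> {1..plength \<nu>}. Suc j \<le> part \<nu> i}"
      using part_pos_iff[of k \<nu>] by auto
  qed
  then have card: "card {i \<in> {1..plength \<nu>}. Suc j \<le> part \<nu> i} = card {i \<in> {..<N}. j < part \<nu> (Suc i)}"
    by (simp add: card_image)
  show ?thesis
  proof (cases "j < part \<nu> 1")
    case True
    then show ?thesis
      unfolding card[symmetric] by (simp add: part_def[of "Defs.conjugate \<nu>"] parts_conjugate del: upt_Suc)
  next
    case False
    then have "{i \<in> {..<N}. j < part \<nu> (Suc i)} = {}"
      using part_antimono[of 1 "Suc _" \<nu>] by (auto simp: not_less intro: order.trans)
    then show ?thesis
      using False by (simp add: part_0 plength_conjugate)
  qed
qed

lemma schur_fps_finite_variables:
  fixes x :: "nat \<Rightarrow> 'a::idom"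
  assumes "plength \<nu> \<le> N"
  shows "schur_fps \<nu> (\<Prod>i<N. 1 + fps_const (x i) * fps_X) * detf N (\<lambda>i j. x i ^ (N - 1 - j)) =
    detf N (\<lambda>i j. x i ^ beads N \<nu> j)"
  unfolding schur_fps_eq_detf plength_conjugate beads_def
  by (rule dual_jacobi_trudi) (use part_antimono[of "Suc _" "Suc _" \<nu>] part_antimono[of 1 "Suc _" \<nu>]
      part_conjugate[OF assms] in auto)

section \<open>Interpolation in $z$\<close>

context not_root_of_unity
begin

text \<open>
  The interpolation parameter is $z$: at $z = q^{-N}$ the coefficients below are those of
  $\prod_{j=1}^N (1 + q^{-j} t)$, and at $z = 0$ those of the series in $\mathcal{E}_\mu$.
\<close>

definition qexp :: "'a \<Rightarrow> 'a fps" where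
  "qexp z = Abs_fps (\<lambda>n. \<Prod>i<n. (1 - z * q ^ i) / (q ^ Suc i - 1))"

lemma qexp_0: "qexp 0 = 1 + Abs_fps (\<lambda>n. if n = 0 then 0 else 1 / (\<Prod>i = 1..n. (q ^ i - 1)))"
  by (rule fps_ext) (auto simp: qexp_def prod.atLeast1_atMost_eq prod_dividef)

text \<open>The functional equation of the q-binomial series: in each coefficient, replacing z by
  z/q shifts the product \<Prod>(1 - z q^i) by one factor.\<close>

lemma qexp_step:
  "qexp (z / q) = qexp z * (1 + fps_const (z / q) * fps_X)"
proof (rule fps_ext)
  fix n
  have nz: "q ^ Suc i - 1 \<noteq> 0" for i
    using q_pow[of "Suc i"] by simp
  show "fps_nth (qexp (z / q)) n = fps_nth (qexp z * (1 + fps_const (z / q) * fps_X)) n"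
  proof (cases n)
    case (Suc m)
    define P where "P = (\<Prod>i<m. 1 - z * q ^ i)"
    define R where "R = (\<Prod>i<m. q ^ Suc i - 1)"
    have R: "R \<noteq> 0"
      using nz by (auto simp: R_def)
    have "(\<Prod>i<Suc m. 1 - z / q * q ^ i) = (1 - z / q) * P"
      using q_nz by (subst prod.lessThan_Suc_shift) (simp add: P_def)
    then have "fps_nth (qexp (z / q)) n = (1 - z / q) * P / (R * (q ^ Suc m - 1))"
      by (simp add: qexp_def Suc prod_dividef R_def)
    moreover have "fps_nth (qexp z * (1 + fps_const (z / q) * fps_X)) n =
        fps_nth (qexp z) (Suc m) + z / q * fps_nth (qexp z) m"
    proof -
      have "qexp z * (1 + fps_const (z / q) * fps_X) = qexp z + fps_const (z / q) * (fps_X * qexp z)"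
        by (simp add: algebra_simps)
      then show ?thesis
        by (simp only: Suc) simp
    qed
    moreover have "fps_nth (qexp z) (Suc m) = P * (1 - z * q ^ m) / (R * (q ^ Suc m - 1))"
      "fps_nth (qexp z) m = P / R"
      by (simp_all add: qexp_def P_def R_def prod_dividef)
    moreover have "P * (1 - z * q ^ m) / (R * (q ^ Suc m - 1)) + z / q * (P / R) =
        (1 - z / q) * P / (R * (q ^ Suc m - 1))"
    proof -
      define y where "y = q ^ Suc m - 1"
      have "P * (1 - z * q ^ m) / (R * y) + z / q * (P / R) =
          (P * (1 - z * q ^ m) + z / q * P * y) / (R * y)"
      proof -
        have "y \<noteq> 0"
          using nz[of m] by (simp only: y_def not_False_eq_True)
        then show ?thesis
          using R by (simp add: divide_simps)
      qed
      also have "P * (1 - z * q ^ m) + z / q * P * y = (1 - z / q) * P"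
      proof -
        have "z / q * P * y = z * q ^ m * P - z / q * P"
          using q_nz by (simp add: y_def right_diff_distrib)
        then show ?thesis
          by (simp add: algebra_simps)
      qed
      finally show ?thesis
        by (simp only: y_def)
    qed
    ultimately show ?thesis
      by simp
  qed (simp add: qexp_def)
qed

text \<open>The functional equation is iterated from \<open>qexp\<close> 1 = 1, where the factor 1 -
  z q^0 kills all higher coefficients.\<close>

lemma qexp_inverse_power:
  "qexp (inverse (q ^ N)) = (\<Prod>i<N. 1 + fps_const (q powi (- int (Suc i))) * fps_X)"
proof (induction N)
  case 0
  show ?case
  proof (rule fps_ext)
    fix n show "fps_nth (qexp (inverse (q ^ 0))) n =
        fps_nth (\<Prod>i<0. 1 + fps_const (q powi (- int (Suc i))) * fps_X) n"
      by (cases n) (auto simp: qexp_def prod.lessThan_Suc_shift simp del: prod.lessThan_Suc)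
  qed
next
  case (Suc N)
  have "inverse (q ^ Suc N) = inverse (q ^ N) / q" "q powi (- int (Suc N)) = inverse (q ^ N) / q"
    using q_nz by (simp_all add: field_simps power_int_minus del: of_nat_Suc)
  then show ?case
    using qexp_step[of "inverse (q ^ N)"] Suc.IH by simp
qed

definition E_interp :: "partition \<Rightarrow> 'a \<Rightarrow> 'a fps" where
  "E_interp \<mu> z = (\<Prod>j = 1..plength \<mu>.
      (1 + fps_const (q powi (int (part \<mu> j) - int j)) * fps_X) /
      (1 + fps_const (q powi (- int j)) * fps_X)) * qexp z"

lemma E_interp_0: "E_interp \<mu> 0 = E_series q \<mu>"
  by (simp add: E_interp_def E_series_def qexp_0)

text \<open>The denominators cancel the first factors of the product for \<open>qexp\<close>; the
  remaining ones belong to zero parts of \<mu> and already have the required form.\<close>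

lemma E_interp_inverse_power:
  assumes "plength \<mu> \<le> N"
  shows "E_interp \<mu> (inverse (q ^ N)) =
    (\<Prod>i<N. 1 + fps_const (q ^ beads N \<mu> i * inverse (q ^ N)) * fps_X)"
proof -
  define f g where "f i = 1 + fps_const (q powi (int (part \<mu> (Suc i)) - int (Suc i))) * fps_X"
    and "g i = 1 + fps_const (q powi (- int (Suc i))) * fps_X" for i
  have g: "h / g i * g i = h" for h i
  proof -
    have "fps_nth (g i) 0 \<noteq> 0"
      by (simp add: g_def)
    then show ?thesis
      by (simp add: fps_divide_unit mult.assoc inverse_mult_eq_1)
  qed
  have f: "f i = 1 + fps_const (q ^ beads N \<mu> i * inverse (q ^ N)) * fps_X" if "i < N" for i
  proof -
    have "int (part \<mu> (Suc i)) - int (Suc i) = int (beads N \<mu> i) - int N"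
      using that by (simp add: beads_def)
    then have "q powi (int (part \<mu> (Suc i)) - int (Suc i)) =
        q powi (int (beads N \<mu> i) - int N)"
      by (rule arg_cong)
    also have "\<dots> = q ^ beads N \<mu> i * inverse (q ^ N)"
      using q_nz by (simp add: power_int_diff divide_inverse)
    finally have "q powi (int (part \<mu> (Suc i)) - int (Suc i)) = q ^ beads N \<mu> i * inverse (q ^ N)" .
    then show ?thesis
      by (simp only: f_def)
  qed
  obtain d where d: "N = plength \<mu> + d"
    using assms le_Suc_ex by blast
  have "(\<Prod>i<plength \<mu>. f i / g i) * (\<Prod>i<N. g i) = (\<Prod>i<plength \<mu>. f i) * (\<Prod>j<d. g (plength \<mu> + j))"
    unfolding d prod_lessThan_add by (simp only: mult.assoc[symmetric] prod.distrib[symmetric] g)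
  also have "(\<Prod>j<d. g (plength \<mu> + j)) = (\<Prod>j<d. f (plength \<mu> + j))"
    by (intro prod.cong) (auto simp: f_def g_def part_0)
  also have "(\<Prod>i<plength \<mu>. f i) * (\<Prod>j<d. f (plength \<mu> + j)) = (\<Prod>i<N. f i)"
    unfolding d prod_lessThan_add ..
  finally show ?thesis
    using f by (simp add: E_interp_def qexp_inverse_power prod.atLeast1_atMost_eq f_def g_def
        del: of_nat_Suc)
qed

text \<open>z enters only through \<open>qexp\<close>, whose coefficients are polynomial in z; the
  rational factors depend on q alone.\<close>

lemma polyfun_schur_fps_E_interp: "polyfun (\<lambda>z. schur_fps \<nu> (E_interp \<mu> z))"
proof -
  have "polyfun (\<lambda>z. fps_nth (qexp z) n)" for n
    unfolding qexp_def fps_nth_Abs_fps divide_inverse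
    by (intro polyfun_prod polyfun_mult polyfun_diff polyfun_const polyfun_id)
  then have "polyfun (\<lambda>z. fps_nth (E_interp \<mu> z) n)" for n
    unfolding E_interp_def fps_mult_nth by (intro polyfun_sum polyfun_mult polyfun_const)
  then have "polyfun (\<lambda>z. if k < (0::int) then 0 else fps_nth (E_interp \<mu> z) (nat k))" for k
    by (cases "k < 0") (auto intro: polyfun_const)
  then show ?thesis
    unfolding schur_fps_eq_detf Let_def by (intro polyfun_detf)
qed

lemma qfact_add: "qfact (n + p) = qfact n * (\<Prod>v<p. 1 - q ^ Suc (n + v))"
  by (simp add: qfact_def prod_lessThan_add)

lemma qdiag_add: "qdiag (n + p) = qdiag n * (\<Prod>v<p. - (q ^ (n + v)) / (1 - q ^ Suc (n + v)))"
  by (simp add: qdiag_def prod_lessThan_add)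

section \<open>The identities\<close>

lemma skew_sum_scale: "c * skew_sum N m \<mu> \<nu> w = skew_sum N m \<mu> \<nu> (\<lambda>\<rho>. c * w \<rho>)"
  by (simp add: skew_sum_def sum_distrib_left mult.assoc)

lemma inverse_power_mult_power: "inverse (q ^ N) * q ^ k = q powi (int k - int N)"
  using q_nz by (simp add: power_int_diff divide_inverse)

text \<open>Each factor 1 - q^(N+v-i) absorbs one power of q^(-N) and becomes q^(-N) - q^(v-i), with
  the content of a box as exponent. Apart from z = q^(-N) no trace of N is left.\<close>

lemma qfact_ratio:
  assumes "i < N"
  shows "inverse (q ^ N) ^ p * (qfact (p + (N - 1 - i)) / qfact (N - 1 - i)) =
    (\<Prod>v<p. inverse (q ^ N) - q powi (int v - int i))"
proof -
  have factor: "inverse (q ^ N) * (1 - q ^ Suc (N - 1 - i + v)) = inverse (q ^ N) - q powi (int v - int i)" for v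
  proof -
    have "int (Suc (N - 1 - i + v)) - int N = int v - int i"
      using assms by simp
    then show ?thesis
      by (simp only: right_diff_distrib inverse_power_mult_power mult_1_right)
  qed
  have "qfact (p + (N - 1 - i)) / qfact (N - 1 - i) = (\<Prod>v<p. 1 - q ^ Suc (N - 1 - i + v))"
    using qfact_nz[of "N - 1 - i"] unfolding add.commute[of p] qfact_add by simp
  then have "inverse (q ^ N) ^ p * (qfact (p + (N - 1 - i)) / qfact (N - 1 - i)) =
      (\<Prod>v<p. inverse (q ^ N) * (1 - q ^ Suc (N - 1 - i + v)))"
    by (simp only: prod.distrib prod_constant card_lessThan)
  then show ?thesis
    by (simp only: factor)
qed

text \<open>The same rescaling, applied to numerator and denominator alike, so no power of q^(-N) is
  needed outside.\<close>

lemma qdiag_ratio: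
  assumes "i < N"
  shows "qdiag (p + (N - 1 - i)) / qdiag (N - 1 - i) =
    (\<Prod>v<p. - (q powi (int v - int i - 1)) / (inverse (q ^ N) - q powi (int v - int i)))"
proof -
  have "- (q ^ (N - 1 - i + v)) / (1 - q ^ Suc (N - 1 - i + v)) =
      - (q powi (int v - int i - 1)) / (inverse (q ^ N) - q powi (int v - int i))" for v
  proof -
    have e: "int (N - 1 - i + v) - int N = int v - int i - 1" "int (Suc (N - 1 - i + v)) - int N = int v - int i"
      using assms by simp_all
    have "- (q ^ (N - 1 - i + v)) / (1 - q ^ Suc (N - 1 - i + v)) =
        (inverse (q ^ N) * - (q ^ (N - 1 - i + v))) / (inverse (q ^ N) * (1 - q ^ Suc (N - 1 - i + v)))"
      using q_nz by (intro mult_divide_mult_cancel_left[symmetric]) simp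
    also have "inverse (q ^ N) * - (q ^ (N - 1 - i + v)) = - (q powi (int v - int i - 1))"
      by (simp only: mult_minus_right inverse_power_mult_power e)
    also have "inverse (q ^ N) * (1 - q ^ Suc (N - 1 - i + v)) = inverse (q ^ N) - q powi (int v - int i)"
      by (simp only: right_diff_distrib inverse_power_mult_power mult_1_right e)
    finally show ?thesis .
  qed
  then show ?thesis
    using qdiag_nz[of "N - 1 - i"] unfolding add.commute[of p] qdiag_add by simp
qed

text \<open>In the quotient of alternants the q-factorials of \<mu> cancel; those of \<nu> and the
  weights of \<rho> are compared with the values for the empty partition.\<close>

lemma schur_fps_E_interp_inverse_power:
  assumes "plength \<mu> \<le> N" "plength \<nu> \<le> N" "part \<nu> 1 \<le> m"
  defines "z \<equiv> inverse (q ^ N)"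
  shows "schur_fps \<nu> (E_interp \<mu> z) * principal_value q (schur \<mu>) =
    skew_sum N m \<mu> \<nu> (\<lambda>\<rho>.
      (\<Prod>j<N. \<Prod>v<part \<nu> (j + 1). z - q powi (int v - int j)) *
      (\<Prod>l<N. \<Prod>v<part \<rho> (l + 1). - (q powi (int v - int l - 1)) / (z - q powi (int v - int l))))"
proof -
  define QA QB QD DD Z ZD where "QA = (\<Prod>i<N. qfact (beads N \<mu> i))"
    and "QB = (\<Prod>i<N. qfact (beads N \<nu> i))" and "QD = (\<Prod>i<N. qfact (N - 1 - i))"
    and "DD = (\<Prod>i<N. qdiag (N - 1 - i))" and "Z = (\<Prod>j<N. z ^ part \<nu> (j + 1))"
    and "ZD = (\<Prod>j<N. z ^ (N - 1 - j))"
  define S s where "S = schur_fps \<nu> (E_interp \<mu> z)" and "s = principal_value q (schur \<mu>)"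
  let ?w = "\<lambda>\<rho>. \<Prod>l<N. qdiag (beads N \<rho> l)"
  have nz: "QA \<noteq> 0" "QD \<noteq> 0" "DD \<noteq> 0" "ZD \<noteq> 0"
    using qfact_nz qdiag_nz q_nz by (auto simp: QA_def QD_def DD_def ZD_def z_def)
  have scale: "detf N (\<lambda>i j. (q ^ beads N \<mu> i * z) ^ k j) =
      (\<Prod>j<N. z ^ k j) * detf N (\<lambda>i j. q ^ (beads N \<mu> i * k j))" for k
  proof -
    have "detf N (\<lambda>i j. (q ^ beads N \<mu> i * z) ^ k j) = detf N (\<lambda>i j. z ^ k j * q ^ (beads N \<mu> i * k j))"
      by (simp only: power_mult_distrib power_mult mult.commute[of _ "z ^ k _"])
    also have "\<dots> = (\<Prod>j<N. z ^ k j) * detf N (\<lambda>i j. q ^ (beads N \<mu> i * k j))"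
      by (rule detf_scale_cols)
    finally show ?thesis .
  qed
  have "S * (ZD * (QA * (QD * (DD * s)))) = (\<Prod>j<N. z ^ beads N \<nu> j) * (QA * (QB * skew_sum N m \<mu> \<nu> ?w))"
    using schur_fps_finite_variables[OF assms(2), of "\<lambda>i. q ^ beads N \<mu> i * z"]
    unfolding scale detf_q_pow_beads[OF assms(1-3)] detf_q_pow_vandermonde(2)[OF assms(1)]
      detf_q_pow_vandermonde(1)[OF assms(1)] E_interp_inverse_power[OF assms(1), folded z_def, symmetric]
    unfolding S_def s_def QA_def QB_def QD_def DD_def ZD_def .
  \<comment> \<open>The staircase part of these powers also occurs in the denominator and cancels;
    the rest, \<open>Z\<close>, is what \<open>qfact_ratio\<close> absorbs.\<close>
  also have "(\<Prod>j<N. z ^ beads N \<nu> j) = Z * ZD"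
    by (simp only: beads_def power_add prod.distrib Z_def ZD_def)
  finally have "(ZD * QA) * (S * s * (QD * DD)) = (ZD * QA) * (Z * QB * skew_sum N m \<mu> \<nu> ?w)"
    by (simp only: mult_ac)
  then have "S * s * (QD * DD) = Z * QB * skew_sum N m \<mu> \<nu> ?w"
    using nz by simp
  then have "S * s = Z * (QB / QD) * (1 / DD) * skew_sum N m \<mu> \<nu> ?w"
    using nz by (simp add: field_simps)
  also have "\<dots> = skew_sum N m \<mu> \<nu> (\<lambda>\<rho>. (Z * (QB / QD)) * (?w \<rho> / DD))"
    unfolding skew_sum_scale by (simp add: mult.assoc)
  also have "Z * (QB / QD) = (\<Prod>j<N. \<Prod>v<part \<nu> (j + 1). z - q powi (int v - int j))"
    unfolding Z_def QB_def QD_def prod_dividef[symmetric] prod.distrib[symmetric] beads_def z_def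
    by (intro prod.cong refl qfact_ratio) simp
  also have "(\<lambda>\<rho>. ?w \<rho> / DD) = (\<lambda>\<rho>. \<Prod>l<N. \<Prod>v<part \<rho> (l + 1).
      - (q powi (int v - int l - 1)) / (z - q powi (int v - int l)))"
    unfolding DD_def prod_dividef[symmetric] beads_def z_def
    by (intro ext prod.cong refl qdiag_ratio) simp
  finally show ?thesis
    unfolding S_def s_def .
qed

text \<open>Partitions longer than \<mu> contribute zero. The index set thereby becomes independent
  of N, as interpolation requires.\<close>

lemma skew_sum_mono:
  assumes "plength \<mu> \<le> n" "n \<le> N"
  shows "skew_sum N m \<mu> \<nu> w = skew_sum n m \<mu> \<nu> w"
  unfolding skew_sum_def
proof (intro sum.mono_neutral_right finite_box_partitions ballI)
  show "box_partitions n m \<subseteq> box_partitions N m"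
    using assms by (auto simp: box_partitions_def)
  fix \<rho> assume "\<rho> \<in> box_partitions N m - box_partitions n m"
  then have "plength \<mu> < plength \<rho>"
    using assms by (auto simp: box_partitions_def)
  then show "w \<rho> * principal_value q (skew_schur \<mu> \<rho>) * principal_value q (skew_schur \<nu> \<rho>) = 0"
    using principal_value_skew_schur_eq_0[of \<mu> \<rho>] by simp
qed

lemma skew_sum_cong:
  assumes "\<And>\<rho>. \<rho> \<in> box_partitions n m \<Longrightarrow> w \<rho> = w' \<rho>"
  shows "skew_sum n m \<mu> \<nu> w = skew_sum n m \<mu> \<nu> w'"
  unfolding skew_sum_def using assms by (intro sum.cong) auto

lemma schur_fps_E_series:
  assumes len: "plength \<mu> \<le> n" "plength \<nu> \<le> n" and m: "part \<nu> 1 \<le> m"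
  shows "schur_fps \<nu> (E_series q \<mu>) * principal_value q (schur \<mu>) =
    (- 1) ^ psize \<nu> * q powi (kappa \<nu> div 2) *
    skew_sum n m \<mu> \<nu> (\<lambda>\<rho>. q powi (- int (psize \<rho>)))"
proof -
  define s where "s = principal_value q (schur \<mu>)"
  define x where "x v l = q powi (int v - int l)" for v l
  define c where "c v l = - (q powi (int v - int l - 1))" for v l
  define U where "U z = (\<Prod>j<n. \<Prod>v<part \<nu> (j + 1). z - x v j)" for z
  define R where "R \<rho> z = (\<Prod>l<n. \<Prod>v<part \<rho> (l + 1). c v l / (z - x v l))" for \<rho> z
  \<comment> \<open>A common denominator of the weights \<open>R\<close>: a row of a partition in
    the box has at most m boxes.\<close>
  define D where "D z = (\<Prod>l<n. \<Prod>v<m. z - x v l)" for z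
  define T where "T \<rho> z = (\<Prod>l<n. (\<Prod>v<part \<rho> (l + 1). c v l) * (\<Prod>v\<in>{part \<rho> (l + 1)..<m}. z - x v l))" for \<rho> z
  define F where "F z = skew_sum n m \<mu> \<nu> (\<lambda>\<rho>. U z * T \<rho> z)" for z
  have DR: "D z * R \<rho> z = T \<rho> z"
    if \<rho>: "\<rho> \<in> box_partitions n m" and nz: "\<And>v l. v < m \<Longrightarrow> l < n \<Longrightarrow> z \<noteq> x v l" for \<rho> z
  proof -
    have "(\<Prod>v<m. z - x v l) * (\<Prod>v<part \<rho> (l + 1). c v l / (z - x v l)) =
        (\<Prod>v<part \<rho> (l + 1). c v l) * (\<Prod>v\<in>{part \<rho> (l + 1)..<m}. z - x v l)" if "l < n" for l
    proof -
      let ?p = "part \<rho> (l + 1)"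
      have p: "?p \<le> m"
        using \<rho> part_antimono[of 1 "l + 1" \<rho>] by (simp add: box_partitions_def)
      then have split: "{..<m} = {..<?p} \<union> {?p..<m}"
        by auto
      have "(\<Prod>v<m. z - x v l) = (\<Prod>v<?p. z - x v l) * (\<Prod>v\<in>{?p..<m}. z - x v l)"
        unfolding split by (rule prod.union_disjoint) auto
      moreover have "(\<Prod>v<?p. z - x v l) * (\<Prod>v<?p. c v l / (z - x v l)) = (\<Prod>v<?p. c v l)"
        unfolding prod.distrib[symmetric]
        by (intro prod.cong refl) (use nz that p in auto)
      ultimately show ?thesis
        by (simp add: mult_ac)
    qed
    then show ?thesis
      unfolding D_def R_def T_def prod.distrib[symmetric] by (intro prod.cong) auto
  qed
  have F_eq: "F z = D z * skew_sum n m \<mu> \<nu> (\<lambda>\<rho>. U z * R \<rho> z)"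
    if "\<And>v l. v < m \<Longrightarrow> l < n \<Longrightarrow> z \<noteq> x v l" for z
    unfolding F_def skew_sum_scale
    by (intro skew_sum_cong) (simp only: DR[OF _ that, symmetric] mult_ac)
  define G where "G z = D z * (schur_fps \<nu> (E_interp \<mu> z) * s)" for z
  have GF: "G (inverse (q ^ N)) = F (inverse (q ^ N))" if N: "n \<le> N" for N
  proof -
    let ?z = "inverse (q ^ N)"
    have cut: "(\<Prod>j<N. \<Prod>v<part \<rho> (j + 1). f v j) = (\<Prod>j<n. \<Prod>v<part \<rho> (j + 1). f v j)"
      if "plength \<rho> \<le> n" for \<rho> and f :: "nat \<Rightarrow> nat \<Rightarrow> 'a"
      using that N by (intro prod.mono_neutral_right) (auto simp: part_0)
    have "schur_fps \<nu> (E_interp \<mu> ?z) * s = skew_sum N m \<mu> \<nu> (\<lambda>\<rho>.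
        (\<Prod>j<N. \<Prod>v<part \<nu> (j + 1). ?z - x v j) *
        (\<Prod>l<N. \<Prod>v<part \<rho> (l + 1). c v l / (?z - x v l)))"
      unfolding s_def x_def c_def using len m N by (intro schur_fps_E_interp_inverse_power) auto
    also have "\<dots> = skew_sum n m \<mu> \<nu> (\<lambda>\<rho>.
        (\<Prod>j<N. \<Prod>v<part \<nu> (j + 1). ?z - x v j) *
        (\<Prod>l<N. \<Prod>v<part \<rho> (l + 1). c v l / (?z - x v l)))"
      by (rule skew_sum_mono[OF len(1) N])
    also have "\<dots> = skew_sum n m \<mu> \<nu> (\<lambda>\<rho>. U ?z * R \<rho> ?z)"
      unfolding U_def R_def by (intro skew_sum_cong) (simp only: cut[OF len(2)] cut box_partitions_def mem_Collect_eq)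
    finally have "G ?z = D ?z * skew_sum n m \<mu> \<nu> (\<lambda>\<rho>. U ?z * R \<rho> ?z)"
      by (simp only: G_def)
    moreover have "?z \<noteq> x v l" if "l < n" for v l
    proof
      assume "?z = x v l"
      then have "inverse (q ^ N) = q ^ v / q ^ l"
        using q_nz by (simp add: x_def power_int_diff)
      then have "q ^ l = q ^ (v + N)"
        using q_nz by (simp add: power_add field_simps)
      then have "l = v + N"
        by (simp only: q_pow_inj)
      then show False
        using that N by simp
    qed
    ultimately show ?thesis
      using F_eq[of ?z] by simp
  qed
  have "G 0 = F 0"
  proof (rule polyfun_eqI[of G F])
    show "polyfun G"
      unfolding G_def D_def
      by (intro polyfun_mult polyfun_prod polyfun_diff polyfun_id polyfun_const polyfun_schur_fps_E_interp)
    show "polyfun F"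
      unfolding F_def skew_sum_def U_def T_def
      by (intro polyfun_sum polyfun_mult polyfun_prod polyfun_diff polyfun_id polyfun_const)
    \<comment> \<open>The interpolation points are pairwise distinct because q is not a root of
      unity.\<close>
    have "inj_on (\<lambda>N. inverse (q ^ N)) {n..}"
      by (intro inj_onI) (simp add: q_pow_inj)
    then have "infinite ((\<lambda>N. inverse (q ^ N)) ` {n..})"
      by (simp add: finite_image_iff infinite_Ici)
    moreover have "(\<lambda>N. inverse (q ^ N)) ` {n..} \<subseteq> {z. G z = F z}"
      using GF by auto
    ultimately show "infinite {z. G z = F z}"
      using infinite_super by blast
  qed
  moreover have x_nz: "0 \<noteq> x v l" for v l
    using q_nz by (simp add: x_def)
  then have "D 0 \<noteq> 0"
    by (simp add: D_def)
  moreover have "F 0 = D 0 * skew_sum n m \<mu> \<nu> (\<lambda>\<rho>. U 0 * R \<rho> 0)"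
    using x_nz by (intro F_eq)
  ultimately have "schur_fps \<nu> (E_series q \<mu>) * s = skew_sum n m \<mu> \<nu> (\<lambda>\<rho>. U 0 * R \<rho> 0)"
    by (simp add: G_def E_interp_0)
  also have "U 0 = (- 1) ^ psize \<nu> * q powi (kappa \<nu> div 2)"
    unfolding U_def x_def diff_0 by (rule prod_minus_contents[OF q_nz len(2)])
  also have "skew_sum n m \<mu> \<nu> (\<lambda>\<rho>. (- 1) ^ psize \<nu> * q powi (kappa \<nu> div 2) * R \<rho> 0) =
      skew_sum n m \<mu> \<nu> (\<lambda>\<rho>. (- 1) ^ psize \<nu> * q powi (kappa \<nu> div 2) * q powi (- int (psize \<rho>)))"
  proof (intro skew_sum_cong arg_cong2[of _ _ _ _ "(*)"] refl)
    fix \<rho> assume "\<rho> \<in> box_partitions n m"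
    then have "plength \<rho> \<le> n"
      by (simp add: box_partitions_def)
    have "c v l / (0 - x v l) = inverse q" for v l
      using q_nz by (simp add: c_def x_def power_int_diff inverse_eq_divide)
    then have "R \<rho> 0 = (\<Prod>l<n. inverse q ^ part \<rho> (l + 1))"
      by (simp add: R_def)
    then have "R \<rho> 0 = inverse q ^ psize \<rho>"
      by (simp only: psize_eq_sum[OF \<open>plength \<rho> \<le> n\<close>] power_sum)
    then show "R \<rho> 0 = q powi (- int (psize \<rho>))"
      by (simp add: power_int_minus power_inverse)
  qed
  finally show ?thesis
    by (simp only: s_def skew_sum_scale)
qed

text \<open>The height of \<rho> is bounded by \<mu> and its width by \<nu>, so the support lies in
  the box.\<close>

lemma Sum_any_skew:
  assumes "plength \<mu> \<le> n" "plength \<nu> \<le> n" "part \<nu> 1 \<le> m"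
  shows "Sum_any (\<lambda>\<rho>. w \<rho> * principal_value q (skew_schur \<mu> \<rho>) * principal_value q (skew_schur \<nu> \<rho>)) =
    skew_sum n m \<mu> \<nu> w"
  unfolding skew_sum_def
proof (rule Sum_any.expand_superset[OF finite_box_partitions], rule subsetI)
  fix \<rho> assume "\<rho> \<in> {\<rho>. w \<rho> * principal_value q (skew_schur \<mu> \<rho>) * principal_value q (skew_schur \<nu> \<rho>) \<noteq> 0}"
  then have "principal_value q (skew_schur \<mu> \<rho>) \<noteq> 0" "principal_value q (skew_schur \<nu> \<rho>) \<noteq> 0"
    by auto
  then have "plength \<rho> \<le> plength \<mu>" "part \<rho> 1 \<le> part \<nu> 1"
    using principal_value_skew_schur_eq_0 by (meson not_le)+
  then show "\<rho> \<in> box_partitions n m"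
    using assms by (simp add: box_partitions_def)
qed

lemma schur_fps_E_series_Sum_any:
  "schur_fps \<nu> (E_series q \<mu>) * principal_value q (schur \<mu>) =
    (- 1) ^ psize \<nu> * q powi (kappa \<nu> div 2) *
    Sum_any (\<lambda>\<rho>. q powi (- int (psize \<rho>)) *
      principal_value q (skew_schur \<mu> \<rho>) * principal_value q (skew_schur \<nu> \<rho>))"
proof -
  define n where "n = max (plength \<mu>) (plength \<nu>)"
  have len: "plength \<mu> \<le> n" "plength \<nu> \<le> n"
    by (auto simp: n_def)
  show ?thesis
    by (simp only: Sum_any_skew[OF len order.refl] schur_fps_E_series[OF len order.refl])
qed

section \<open>The closed form of W_\<mu>\<close>

lemma power_diff_eq_bracket:
  assumes "r \<noteq> 0"
  shows "r\<^sup>2 ^ k - r\<^sup>2 ^ l = r ^ (k + l) * bracket r (int k - int l)"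
  using assms by (simp add: bracket_def power_int_diff power_add power_mult[symmetric]
      power2_eq_square field_simps flip: power_mult_distrib)

lemma prod_pairs_power_add:
  "(\<Prod>i<n. \<Prod>j<i. r ^ (p j + p i)) = (\<Prod>i<n. (r ^ p i) ^ (n - 1))" for r :: 'a and p :: "nat \<Rightarrow> nat"
proof (induction n)
  case (Suc n)
  have "(\<Prod>i<n. (r ^ p i) ^ (n - 1)) * (\<Prod>i<n. r ^ p i) = (\<Prod>i<n. (r ^ p i) ^ n)"
    unfolding prod.distrib[symmetric] by (intro prod.cong refl) (auto simp flip: power_Suc2)
  moreover have "(\<Prod>j<n. r ^ (p j + p n)) = (\<Prod>j<n. r ^ p j) * (r ^ p n) ^ n"
    by (simp add: power_add prod.distrib)
  ultimately show ?case
    by (simp only: prod.lessThan_Suc Suc.IH diff_Suc_1 mult.assoc[symmetric])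
qed simp

text \<open>The product formula for \<mu> is divided by the one for the empty partition. Differences
  of powers of q are brackets up to powers of r, so B/B0 and 1/Z are the two products in
  \<open>W1\<close>, and K/X collects signs and powers.\<close>

lemma W1_eq:
  assumes r: "r\<^sup>2 = q"
  shows "W1 r \<mu> = (- 1) ^ psize \<mu> * r powi (kappa \<mu> + int (psize \<mu>)) * principal_value q (schur \<mu>)"
proof -
  define n where "n = plength \<mu>"
  define p where "p i = part \<mu> (i + 1)" for i
  define d where "d i = n - 1 - i" for i
  define s where "s = principal_value q (schur \<mu>)"
  have "r \<noteq> 0"
    using r q_nz by auto
  have beads: "beads n \<mu> i = p i + d i" for i
    by (simp add: beads_def p_def d_def)
  define B where "B = (\<Prod>i<n. \<Prod>j<i. bracket r (int (p j + d j) - int (p i + d i)))"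
  define B0 where "B0 = (\<Prod>i<n. \<Prod>j<i. bracket r (int (d j) - int (d i)))"
  define X where "X = (\<Prod>i<n. \<Prod>j<i. r ^ (p j + p i))"
  define Y where "Y = (\<Prod>i<n. \<Prod>j<i. r ^ (d j + d i))"
  define QD where "QD = (\<Prod>i<n. qfact (d i))"
  define DD where "DD = (\<Prod>i<n. qdiag (d i))"
  define Z where "Z = (\<Prod>i<n. \<Prod>v<p i. bracket r (int (Suc (d i + v))))"
  define K where "K = (\<Prod>i<n. \<Prod>v<p i. - (r ^ Suc (d i + v)))"
  have V: "(\<Prod>i<n. \<Prod>j<i. q ^ (p j + d j) - q ^ (p i + d i)) = X * Y * B"
    unfolding r[symmetric] power_diff_eq_bracket[OF \<open>r \<noteq> 0\<close>] X_def Y_def B_def prod.distrib[symmetric]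
    by (intro prod.cong refl) (simp add: power_add mult_ac)
  have V0: "(\<Prod>i<n. \<Prod>j<i. q ^ d j - q ^ d i) = Y * B0"
    unfolding r[symmetric] power_diff_eq_bracket[OF \<open>r \<noteq> 0\<close>] Y_def B0_def prod.distrib[symmetric] ..
  have "1 - q ^ k = - (r ^ k) * bracket r (int k)" for k
  proof -
    have "q ^ k - 1 = r ^ k * bracket r (int k)"
      using power_diff_eq_bracket[OF \<open>r \<noteq> 0\<close>, of k 0] unfolding r by simp
    then show ?thesis
      by (metis minus_diff_eq mult_minus_left)
  qed
  then have QA: "(\<Prod>i<n. qfact (p i + d i)) = QD * (K * Z)"
    unfolding add.commute[of "p _"] qfact_add QD_def K_def Z_def by (simp only: prod.distrib)
  have mu: "X * Y * B = QD * (K * Z) * (QD * (DD * s))"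
    using detf_q_pow_vandermonde(1)[of \<mu> n] unfolding beads V QA
    by (simp add: n_def s_def QD_def DD_def d_def)
  have empty: "Y * B0 = QD * (QD * DD)"
  proof -
    have "principal_value q (schur (Partition [])) = 1"
      by (subst principal_value_schur[of _ 0]) auto
    then show ?thesis
      using detf_q_pow_vandermonde(1)[of "Partition []" n] unfolding beads_empty d_def[symmetric] V0
      by (simp add: QD_def DD_def)
  qed
  \<comment> \<open>\<open>Y\<close>, \<open>QD\<close> and \<open>DD\<close> stem from the empty
    partition and disappear on dividing \<open>mu\<close> by \<open>empty\<close>.\<close>
  have "Y * (X * B) = QD * (QD * DD) * (K * Z * s)"
    using mu by (simp only: mult_ac)
  then have "Y * (X * B) = Y * (B0 * (K * Z) * s)"
    by (simp only: empty[symmetric] mult.assoc)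
  moreover have nz: "Y \<noteq> 0" "X \<noteq> 0"
    using \<open>r \<noteq> 0\<close> by (auto simp: X_def Y_def)
  ultimately have XB: "X * B = B0 * (K * Z) * s"
    by simp
  have "Y * B0 \<noteq> 0"
    using q_vandermonde_nz[of n "Partition []"] unfolding beads_empty d_def[symmetric] V0 .
  moreover have "QD * (K * Z) \<noteq> 0"
    using qfact_nz by (simp flip: QA)
  ultimately have B0: "B0 \<noteq> 0" and Z: "Z \<noteq> 0"
    by auto
  \<comment> \<open>A box (i, v) gives -r^(d_i+v+1) in \<open>K\<close> and r^(n-1) in
    \<open>X\<close>, since index i lies in n-1 pairs; the quotient is -r^(content+1).\<close>
  have "K / X = (\<Prod>i<n. (\<Prod>v<p i. - (r ^ Suc (d i + v))) / (r ^ p i) ^ (n - 1))"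
    unfolding K_def X_def prod_pairs_power_add prod_dividef ..
  also have "\<dots> = (\<Prod>i<n. \<Prod>v<p i. - (r powi (int v - int i)) * r)"
  proof (intro prod.cong refl)
    fix i assume "i \<in> {..<n}"
    then have e: "int (Suc (d i + v)) - int (n - 1) = int v - int i + 1" for v
      by (simp add: d_def)
    have "(\<Prod>v<p i. - (r ^ Suc (d i + v))) / (r ^ p i) ^ (n - 1) =
        (\<Prod>v<p i. - (r ^ Suc (d i + v)) / r ^ (n - 1))"
      unfolding prod_dividef prod_constant card_lessThan power_mult[symmetric]
      by (simp only: mult.commute[of "p i"])
    moreover have "- (r ^ Suc (d i + v)) / r ^ (n - 1) = - (r powi (int v - int i)) * r" for v
    proof -
      have "r ^ Suc (d i + v) / r ^ (n - 1) = r powi (int (Suc (d i + v)) - int (n - 1))"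
        using \<open>r \<noteq> 0\<close> by (simp add: power_int_diff del: of_nat_Suc of_nat_diff)
      also have "\<dots> = r powi (int v - int i) * r"
        using \<open>r \<noteq> 0\<close> by (simp only: e) (simp add: power_int_add)
      finally show ?thesis
        by simp
    qed
    ultimately show "(\<Prod>v<p i. - (r ^ Suc (d i + v))) / (r ^ p i) ^ (n - 1) =
        (\<Prod>v<p i. - (r powi (int v - int i)) * r)"
      by (simp only:)
  qed
  also have "\<dots> = (- 1) ^ psize \<mu> * r powi (kappa \<mu> div 2) * r ^ psize \<mu>"
    unfolding prod.distrib p_def prod_minus_contents[OF \<open>r \<noteq> 0\<close>, of \<mu> n, unfolded n_def, OF order.refl, folded n_def]
    by (simp add: psize_eq_sum[of \<mu> n] n_def power_sum)
  finally have KX: "K / X = (- 1) ^ psize \<mu> * r powi (kappa \<mu> div 2) * r ^ psize \<mu>" .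
  have "(\<Prod>j = 1..plength \<mu>. \<Prod>i\<in>{1..<j}.
      bracket r (int (part \<mu> i) - int (part \<mu> j) + int j - int i) / bracket r (int j - int i)) = B / B0"
  proof -
    have inner: "(\<Prod>i\<in>{1..<Suc j}. bracket r (int (part \<mu> i) - int (part \<mu> (Suc j)) + int (Suc j) - int i) /
        bracket r (int (Suc j) - int i)) = (\<Prod>i<j. bracket r (int (p i + d i) - int (p j + d j)) /
        bracket r (int (d i) - int (d j)))" if "j < n" for j
    proof -
      have "(\<Prod>i\<in>{1..<Suc j}. bracket r (int (part \<mu> i) - int (part \<mu> (Suc j)) + int (Suc j) - int i) /
        bracket r (int (Suc j) - int i)) =
        (\<Prod>i<j. bracket r (int (part \<mu> (Suc i)) - int (part \<mu> (Suc j)) + int (Suc j) - int (Suc i)) /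
        bracket r (int (Suc j) - int (Suc i)))"
        unfolding One_nat_def prod.shift_bounds_Suc_ivl atLeast0LessThan ..
      also have "\<dots> = (\<Prod>i<j. bracket r (int (p i + d i) - int (p j + d j)) / bracket r (int (d i) - int (d j)))"
        using that by (intro prod.cong refl arg_cong2[of _ _ _ _ "(/)"] arg_cong[of _ _ "bracket r"])
          (auto simp: p_def d_def)
      finally show ?thesis .
    qed
    show ?thesis
      unfolding B_def B0_def prod_dividef[symmetric] n_def[symmetric] One_nat_def prod.atLeast1_atMost_eq
      by (rule prod.cong[OF refl], rule inner[unfolded One_nat_def], simp)
  qed
  moreover have "(\<Prod>i = 1..plength \<mu>. \<Prod>v = 1..part \<mu> i. 1 / bracket r (int v - int i + int (plength \<mu>))) = 1 / Z"
  proof -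
    have "(\<Prod>i = 1..plength \<mu>. \<Prod>v = 1..part \<mu> i. 1 / bracket r (int v - int i + int (plength \<mu>))) =
        (\<Prod>i<n. \<Prod>v<p i. 1 / bracket r (int (Suc v) - int (Suc i) + int n))"
      unfolding n_def[symmetric] One_nat_def prod.atLeast1_atMost_eq p_def by simp
    also have "\<dots> = (\<Prod>i<n. \<Prod>v<p i. 1 / bracket r (int (Suc (d i + v))))"
      by (intro prod.cong refl arg_cong2[of _ _ _ _ "(/)"] arg_cong[of _ _ "bracket r"]) (auto simp: d_def)
    finally show ?thesis
      by (simp add: Z_def prod_dividef)
  qed
  ultimately have "W1 r \<mu> = r powi (kappa \<mu> div 2) * (B / B0) * (1 / Z)"
    by (simp only: W1_def)
  also have "B / B0 * (1 / Z) = K / X * s"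
    using XB B0 Z nz by (simp add: divide_simps mult_ac)
  then have "r powi (kappa \<mu> div 2) * (B / B0) * (1 / Z) = r powi (kappa \<mu> div 2) * (K / X * s)"
    by (simp only: mult.assoc)
  also have "\<dots> = (- 1) ^ psize \<mu> * (r powi (kappa \<mu> div 2) * r powi (kappa \<mu> div 2) * r powi int (psize \<mu>)) * s"
    by (simp add: KX mult_ac)
  also have "r powi (kappa \<mu> div 2) * r powi (kappa \<mu> div 2) * r powi int (psize \<mu>) =
      r powi (kappa \<mu> div 2 + kappa \<mu> div 2 + int (psize \<mu>))"
    using \<open>r \<noteq> 0\<close> by (simp only: power_int_add simp_thms)
  \<comment> \<open>One half comes from the prefactor of \<open>W1\<close>, the other from
    \<open>K / X\<close>; the division by 2 is exact.\<close>
  also have "kappa \<mu> div 2 + kappa \<mu> div 2 = kappa \<mu>"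
    using even_kappa[of \<mu>] by (simp flip: mult_2)
  finally show ?thesis
    by (simp only: s_def)
qed

end

theorem theorem5p1:
  fixes q :: "'a::field_char_0" and \<mu> \<nu> :: partition
  assumes "q \<noteq> 0" and "\<And>n. n \<ge> 1 \<Longrightarrow> q ^ n \<noteq> 1"
  shows "schur_fps \<nu> (E_series q \<mu>) =
           (- 1) ^ psize \<nu> * q powi (kappa \<nu> div 2) *
           Sum_any (\<lambda>\<rho>. q powi (- int (psize \<rho>)) *
             (principal_value q (skew_schur \<mu> \<rho>) / principal_value q (schur \<mu>)) *
             principal_value q (skew_schur \<nu> \<rho>))
         \<and> (\<forall>r. r\<^sup>2 = q \<longrightarrow>
           W2 r \<mu> \<nu> =
             (- 1) ^ (psize \<mu> + psize \<nu>) *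
             r powi (kappa \<mu> + kappa \<nu> + int (psize \<mu>) + int (psize \<nu>)) *
             Sum_any (\<lambda>\<rho>. q powi (- int (psize \<rho>)) *
               principal_value q (skew_schur \<mu> \<rho>) * principal_value q (skew_schur \<nu> \<rho>)))"
proof -
  interpret not_root_of_unity q
    using assms by unfold_locales
  define s where "s = principal_value q (schur \<mu>)"
  define \<Sigma> where "\<Sigma> = Sum_any (\<lambda>\<rho>. q powi (- int (psize \<rho>)) *
    principal_value q (skew_schur \<mu> \<rho>) * principal_value q (skew_schur \<nu> \<rho>))"
  have s: "s \<noteq> 0"
    by (simp add: s_def principal_value_schur_nz)
  have main: "schur_fps \<nu> (E_series q \<mu>) * s = (- 1) ^ psize \<nu> * q powi (kappa \<nu> div 2) * \<Sigma>"
    unfolding s_def \<Sigma>_def by (rule schur_fps_E_series_Sum_any)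
  \<comment> \<open>A constant is moved out of \<open>Sum_any\<close> by passing through the finite
    sum \<open>skew_sum\<close>, which displays a finite support.\<close>
  have Sum_div: "Sum_any (\<lambda>\<rho>. q powi (- int (psize \<rho>)) *
      (principal_value q (skew_schur \<mu> \<rho>) / s) * principal_value q (skew_schur \<nu> \<rho>)) = \<Sigma> / s"
  proof -
    define n where "n = max (plength \<mu>) (plength \<nu>)"
    have len: "plength \<mu> \<le> n" "plength \<nu> \<le> n"
      by (auto simp: n_def)
    have "(\<lambda>\<rho>. q powi (- int (psize \<rho>)) *
        (principal_value q (skew_schur \<mu> \<rho>) / s) * principal_value q (skew_schur \<nu> \<rho>)) =
        (\<lambda>\<rho>. (1 / s * q powi (- int (psize \<rho>))) *
          principal_value q (skew_schur \<mu> \<rho>) * principal_value q (skew_schur \<nu> \<rho>))"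
      by (simp add: mult_ac)
    then show ?thesis
      unfolding \<Sigma>_def by (simp only: Sum_any_skew[OF len order.refl] flip: skew_sum_scale) simp
  qed
  have "schur_fps \<nu> (E_series q \<mu>) = (- 1) ^ psize \<nu> * q powi (kappa \<nu> div 2) *
      Sum_any (\<lambda>\<rho>. q powi (- int (psize \<rho>)) *
        (principal_value q (skew_schur \<mu> \<rho>) / s) * principal_value q (skew_schur \<nu> \<rho>))"
    unfolding Sum_div using main s by (simp add: eq_divide_eq)
  moreover have "W2 r \<mu> \<nu> = (- 1) ^ (psize \<mu> + psize \<nu>) *
      r powi (kappa \<mu> + kappa \<nu> + int (psize \<mu>) + int (psize \<nu>)) * \<Sigma>" if r: "r\<^sup>2 = q" for r
  proof -
    have "r \<noteq> 0"
      using r assms(1) by auto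
    have "q powi (kappa \<nu> div 2) = r powi (2 * (kappa \<nu> div 2))"
      unfolding r[symmetric] by (simp add: power_int_mult)
    then have q: "q powi (kappa \<nu> div 2) = r powi (kappa \<nu>)"
      using even_kappa[of \<nu>] by simp
    have "W2 r \<mu> \<nu> = r ^ psize \<nu> * ((- 1) ^ psize \<mu> * r powi (kappa \<mu> + int (psize \<mu>))) *
        (schur_fps \<nu> (E_series q \<mu>) * s)"
      unfolding W2_def W1_eq[OF r] r s_def by (simp only: mult_ac)
    also have "\<dots> = (- 1) ^ (psize \<mu> + psize \<nu>) *
        (r powi int (psize \<nu>) * r powi (kappa \<mu> + int (psize \<mu>)) * r powi kappa \<nu>) * \<Sigma>"
      unfolding main q by (simp add: power_add mult_ac)
    also have "r powi int (psize \<nu>) * r powi (kappa \<mu> + int (psize \<mu>)) * r powi kappa \<nu> =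
        r powi (int (psize \<nu>) + (kappa \<mu> + int (psize \<mu>)) + kappa \<nu>)"
      using \<open>r \<noteq> 0\<close> by (simp add: power_int_add)
    also have "int (psize \<nu>) + (kappa \<mu> + int (psize \<mu>)) + kappa \<nu> =
        kappa \<mu> + kappa \<nu> + int (psize \<mu>) + int (psize \<nu>)"
      by simp
    finally show ?thesis .
  qed
  ultimately show ?thesis
    unfolding s_def \<Sigma>_def by blast
qed

end
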